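(* For every $p\in(0,1)$, the limit $\alpha=\alpha(p)\in(1/2,1)$ in probability of $\log\mathrm{LIS}(T_n)/\log n$ is the unique solution in $(1/2,1)$ of $$\frac{1}{4^{\frac{1}{2\alpha}}\sqrt{\pi}}\,\frac{\Gamma\big(\tfrac12-\tfrac1{2\alpha}\big)}{\Gamma\big(1-\tfrac1{2\alpha}\big)}=\frac{p}{p-1}.$$
   Context: A sign-decorated binary tree is a finite planar rooted tree in which every internal vertex (node) has exactly two ordered children and carries a sign $\oplus$ or $\ominus$. A subtree induced by a set of leaves $\mathcal L$ is obtained by deleting vertices with no descendant in $\mathcal L$ and contracting vertices with one child; it is positive if all its nodes carry $\oplus$. $\mathrm{LIS}(t)$ is the maximal number of leaves of a positive subtree of $t$. Fix $p\in(0,1)$. $T_n$ is a uniform planar rooted binary tree with $n$ leaves with i.i.d. node signs, $\mathbb P(\oplus)=p$. It is known (from the previous result) that $\log\mathrm{LIS}(T_n)/\log n$ converges in probability to some $\alpha\in(1/2,1)$. *)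

theory Defs
  imports "HOL-Probability.Probability"
begin

text \<open>Sign-decorated planar binary trees: the boolean at a node is True for the sign
  plus and False for the sign minus.\<close>
datatype stree = Leaf | Node bool stree stree

fun leaves :: "stree \<Rightarrow> bool list set" where
  "leaves Leaf = {[]}"
| "leaves (Node s l r) = Cons False ` leaves l \<union> Cons True ` leaves r"

fun nleaves :: "stree \<Rightarrow> nat" where
  "nleaves Leaf = 1"
| "nleaves (Node s l r) = nleaves l + nleaves r"

fun allpos :: "stree \<Rightarrow> bool" where
  "allpos Leaf = True"
| "allpos (Node s l r) = (s \<and> allpos l \<and> allpos r)"

fun induce :: "bool list set \<Rightarrow> stree \<Rightarrow> stree option" where
  "induce L Leaf = (if [] \<in> L then Some Leaf else None)"
| "induce L (Node s l r) =
     (case (induce {q. False # q \<in> L} l, induce {q. True # q \<in> L} r) of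
        (None, None) \<Rightarrow> None
      | (Some a, None) \<Rightarrow> Some a
      | (None, Some b) \<Rightarrow> Some b
      | (Some a, Some b) \<Rightarrow> Some (Node s a b))"

definition positive_leafset :: "stree \<Rightarrow> bool list set \<Rightarrow> bool" where
  "positive_leafset t L \<longleftrightarrow> L \<subseteq> leaves t \<and> L \<noteq> {} \<and>
     (case induce L t of Some u \<Rightarrow> allpos u | None \<Rightarrow> False)"

definition LIS :: "stree \<Rightarrow> nat" where
  "LIS t = Max {card L | L. positive_leafset t L}"

fun resign :: "real \<Rightarrow> stree \<Rightarrow> stree pmf" where
  "resign p Leaf = return_pmf Leaf"
| "resign p (Node s l r) =
     bind_pmf (bernoulli_pmf p) (\<lambda>s'. bind_pmf (resign p l) (\<lambda>l'.
       bind_pmf (resign p r) (\<lambda>r'. return_pmf (Node s' l' r'))))"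

text \<open>T_n: uniform planar binary tree shape with n leaves, with i.i.d. node signs.\<close>
definition random_tree :: "real \<Rightarrow> nat \<Rightarrow> stree pmf" where
  "random_tree p n = bind_pmf (pmf_of_set {t. nleaves t = n \<and> allpos t}) (resign p)"

end

theory Submission
  imports Defs "HOL-Real_Asymp.Real_Asymp"
begin

text \<open>
  \<open>LIS\<close> obeys a recursion: it is additive at nodes with sign plus and a maximum at nodes with sign
  minus. For a critical binary Galton--Watson tree \<open>T\<close> with random signs, splitting at the root
  shows that \<open>G m = P (LIS T \<ge> m)\<close> satisfies, for \<open>m \<ge> 2\<close>,
  \<open>(G m)\<^sup>2 = p * P (X < m, Y < m, X + Y \<ge> m)\<close> with \<open>X, Y\<close> independent copies of \<open>LIS T\<close>.
  This determines \<open>G\<close> monotonically from \<open>G 1 = 1\<close>, so sub- and supersolutions bound it. For a pure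
  power \<open>m powr (- g)\<close> the equation becomes
  \<open>1 / p = 1 + (2 g - 1) Beta (1 - g) (1 - g)\<close>, which is the equation of the theorem for
  \<open>g = 1 / (2 \<alpha>)\<close>; its solution gives \<open>G m \<le> m powr (- g)\<close>, and every larger exponent \<open>\<theta>\<close>
  gives \<open>G m \<ge> c * m powr (- \<theta>)\<close>.

  Both bounds carry over to the tree \<open>T\<^sub>n\<close> with \<open>n\<close> leaves. By Remy's leaf insertion
  \<open>P (LIS T\<^sub>n \<ge> m)\<close> increases with \<open>n\<close>, hence is at most \<open>G m / P (|T| \<ge> n)\<close>, which is of order
  \<open>G m * sqrt n\<close>. Conversely, the generating function in the number of leaves of the trees with
  \<open>LIS < m\<close> is still at most 1 at \<open>1 + (G m)\<^sup>2 / 2\<close>, so \<open>P (LIS T\<^sub>n < m)\<close> decays like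
  \<open>exp (- c n (G m)\<^sup>2)\<close> up to a polynomial factor.
\<close>

section \<open>The recursion for the longest positive subtree\<close>

fun lis :: "stree \<Rightarrow> nat" where
  "lis Leaf = 1"
| "lis (Node s l r) = (if s then lis l + lis r else max (lis l) (lis r))"

lemma lis_pos: "lis t \<ge> 1"
  by (induction t) auto

lemma finite_leaves: "finite (leaves t)"
  by (induction t) auto

lemma induce_eq_None_iff: "induce L t = None \<longleftrightarrow> L \<inter> leaves t = {}"
proof (induction t arbitrary: L)
  case (Node s l r)
  have "L \<inter> leaves (Node s l r) = {} \<longleftrightarrow>
        {q. False # q \<in> L} \<inter> leaves l = {} \<and> {q. True # q \<in> L} \<inter> leaves r = {}"
    by (simp add: disjoint_iff image_iff) blast
  moreover have "induce L (Node s l r) = None \<longleftrightarrow>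
        induce {q. False # q \<in> L} l = None \<and> induce {q. True # q \<in> L} r = None"
    by (simp split: option.splits)
  ultimately show ?case
    by (simp only: Node.IH)
qed simp

lemma positive_leafset_finite: "positive_leafset t L \<Longrightarrow> finite L"
  using finite_leaves finite_subset by (auto simp: positive_leafset_def)

lemma node_leafset_decomp:
  assumes "L \<subseteq> leaves (Node s l r)"
  shows "L = Cons False ` {q. False # q \<in> L} \<union> Cons True ` {q. True # q \<in> L}"
    and "{q. False # q \<in> L} \<subseteq> leaves l" and "{q. True # q \<in> L} \<subseteq> leaves r"
  using assms by (auto simp: image_iff)

lemma card_Cons_Un:
  assumes "finite A" "finite B"
  shows "card (Cons False ` A \<union> Cons True ` B) = card A + card B"
  using assms by (subst card_Un_disjoint) (auto simp: card_image)

text \<open>A node survives in the induced tree only if \<open>L\<close> meets both of its subtrees.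
  Hence at a minus root all of \<open>L\<close> lies on one side, while at a plus root the two parts
  add up.\<close>

lemma positive_leafset_card_le: "positive_leafset t L \<Longrightarrow> card L \<le> lis t"
proof (induction t arbitrary: L)
  case Leaf
  then show ?case by (auto simp: positive_leafset_def subset_singleton_iff)
next
  case (Node s l r)
  define L0 where "L0 = {q. False # q \<in> L}"
  define L1 where "L1 = {q. True # q \<in> L}"
  have sub: "L \<subseteq> leaves (Node s l r)" and ne: "L \<noteq> {}"
    using Node.prems by (auto simp: positive_leafset_def)
  note d = node_leafset_decomp[OF sub, folded L0_def L1_def]
  have fin: "finite L0" "finite L1"
    using d finite_leaves finite_subset by blast+
  have card: "card L = card L0 + card L1"
    using card_Cons_Un[OF fin] d(1) by simp
  have pos: "case (case (induce L0 l, induce L1 r) of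
        (None, None) \<Rightarrow> None
      | (Some a, None) \<Rightarrow> Some a
      | (None, Some b) \<Rightarrow> Some b
      | (Some a, Some b) \<Rightarrow> Some (Node s a b)) of Some u \<Rightarrow> allpos u | None \<Rightarrow> False"
    using Node.prems unfolding positive_leafset_def L0_def L1_def induce.simps by blast
  have none: "induce L0 l = None \<longleftrightarrow> L0 = {}" "induce L1 r = None \<longleftrightarrow> L1 = {}"
    using d by (auto simp: induce_eq_None_iff)
  consider (left) a where "induce L0 l = Some a" "induce L1 r = None"
    | (right) b where "induce L0 l = None" "induce L1 r = Some b"
    | (both) a b where "induce L0 l = Some a" "induce L1 r = Some b"
    using pos by (auto split: option.splits)
  then show ?case
  proof cases
    case left
    then have "positive_leafset l L0" "card L1 = 0"
      using pos none d(2) by (auto simp: positive_leafset_def)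
    with Node.IH(1)[of L0] show ?thesis using card by auto
  next
    case right
    then have "positive_leafset r L1" "card L0 = 0"
      using pos none d(3) by (auto simp: positive_leafset_def)
    with Node.IH(2)[of L1] show ?thesis using card by auto
  next
    case both
    then have "s" "positive_leafset l L0" "positive_leafset r L1"
      using pos none d(2,3) by (auto simp: positive_leafset_def)
    then show ?thesis using Node.IH(1)[of L0] Node.IH(2)[of L1] card by auto
  qed
qed

lemma positive_leafset_attained: "\<exists>L. positive_leafset t L \<and> card L = lis t"
proof (induction t)
  case Leaf
  show ?case by (rule exI[of _ "{[]}"]) (auto simp: positive_leafset_def)
next
  case (Node s l r)
  then obtain L0 L1 where L0: "positive_leafset l L0" "card L0 = lis l"
    and L1: "positive_leafset r L1" "card L1 = lis r" by blast
  have left: "positive_leafset (Node s l r) (Cons False ` L0)"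
    using L0 induce_eq_None_iff[of "{}" r] unfolding positive_leafset_def
    by (auto split: option.splits simp: image_iff)
  have right: "positive_leafset (Node s l r) (Cons True ` L1)"
    using L1 induce_eq_None_iff[of "{}" l] unfolding positive_leafset_def
    by (auto split: option.splits simp: image_iff)
  have both: "positive_leafset (Node s l r) (Cons False ` L0 \<union> Cons True ` L1)" if s
    using L0 L1 that unfolding positive_leafset_def
    by (auto split: option.splits simp: image_iff)
  have "card (Cons False ` L0) = lis l" "card (Cons True ` L1) = lis r"
    using L0 L1 by (auto simp: card_image)
  moreover have "card (Cons False ` L0 \<union> Cons True ` L1) = lis l + lis r"
    using card_Cons_Un[of L0 L1] positive_leafset_finite L0 L1 by auto
  ultimately show ?case
    using left right both by (cases s) (auto simp: max_def)
qed

lemma LIS_eq_lis: "LIS t = lis t"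
  unfolding LIS_def
proof (rule Max_eqI)
  show "finite {card L | L. positive_leafset t L}"
    by (rule finite_subset[of _ "{..lis t}"]) (auto dest: positive_leafset_card_le)
  show "y \<le> lis t" if "y \<in> {card L |L. positive_leafset t L}" for y
    using that positive_leafset_card_le by auto
  show "lis t \<in> {card L |L. positive_leafset t L}"
    using positive_leafset_attained[of t] by (metis (mono_tags, lifting) mem_Collect_eq)
qed

section \<open>Galton--Watson weights and leaf deletion\<close>

definition trees :: "nat \<Rightarrow> stree set" where
  "trees n = {t. nleaves t = n}"

lemma nleaves_pos: "nleaves t \<ge> 1"
  by (induction t) auto

lemma trees_0 [simp]: "trees 0 = {}"
  using nleaves_pos by (auto simp: trees_def Suc_le_eq)

lemma finite_trees [simp]: "finite (trees n)"
proof (induction n rule: less_induct)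
  case (less n)
  have "trees n \<subseteq> {Leaf} \<union>
     (\<Union>i\<in>{..<n}. \<Union>j\<in>{..<n}. (\<lambda>(s,l,r). Node s l r) ` (UNIV \<times> trees i \<times> trees j))"
  proof
    fix t assume t: "t \<in> trees n"
    show "t \<in> {Leaf} \<union>
     (\<Union>i\<in>{..<n}. \<Union>j\<in>{..<n}. (\<lambda>(s,l,r). Node s l r) ` (UNIV \<times> trees i \<times> trees j))"
    proof (cases t)
      case (Node s l r)
      then have "nleaves l < n" "nleaves r < n"
        using t nleaves_pos[of l] nleaves_pos[of r] by (auto simp: trees_def)
      then show ?thesis using Node
        by (auto simp: trees_def image_iff)
    qed auto
  qed
  moreover have "finite \<dots>"
    using less by auto
  ultimately show ?case by (rule finite_subset)
qed

text \<open>Decomposition at the root, with \<open>i\<close> the number of leaves on the left. The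
  extreme indices \<open>i = 0\<close> and \<open>i = n\<close> contribute nothing because
  \<open>trees 0\<close> is empty.\<close>

lemma sum_trees:
  fixes f :: "stree \<Rightarrow> 'a::comm_monoid_add"
  shows "(\<Sum>t\<in>trees n. f t) = (if n = 1 then f Leaf else 0) +
    (\<Sum>i\<le>n. \<Sum>l\<in>trees i. \<Sum>r\<in>trees (n - i). f (Node True l r) + f (Node False l r))"
proof -
  define L where "L = (if n = 1 then {Leaf} else {})"
  define S where "S = (SIGMA i:{..n}. trees i \<times> trees (n - i) \<times> (UNIV :: bool set))"
  define g where "g = (\<lambda>(i::nat, l, r, s). Node s l r)"
  have inj: "inj_on g S"
    by (auto simp: inj_on_def g_def S_def trees_def)
  have img: "trees n = L \<union> g ` S"
  proof (intro equalityI subsetI)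
    fix t assume t: "t \<in> trees n"
    show "t \<in> L \<union> g ` S"
    proof (cases t)
      case Leaf
      then show ?thesis using t by (auto simp: L_def trees_def)
    next
      case (Node s l r)
      then have "(nleaves l, l, r, s) \<in> S" "g (nleaves l, l, r, s) = t"
        using t by (auto simp: S_def trees_def g_def)
      then show ?thesis by force
    qed
  next
    fix t assume "t \<in> L \<union> g ` S"
    then show "t \<in> trees n"
      by (auto simp: L_def S_def g_def trees_def split: if_splits)
  qed
  have disj: "L \<inter> g ` S = {}" by (auto simp: L_def g_def)
  have fin: "finite L" "finite S" by (auto simp: L_def S_def)
  have "(\<Sum>t\<in>trees n. f t) = sum f L + sum f (g ` S)"
    unfolding img using fin disj by (intro sum.union_disjoint) auto
  also have "sum f (g ` S) = (\<Sum>x\<in>S. f (g x))"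
    using inj by (simp add: sum.reindex)
  also have "\<dots> = (\<Sum>i\<le>n. \<Sum>y\<in>trees i \<times> trees (n - i) \<times> (UNIV :: bool set). f (g (i, y)))"
    unfolding S_def by (subst sum.Sigma) (auto simp: case_prod_beta)
  also have "\<dots> = (\<Sum>i\<le>n. \<Sum>l\<in>trees i. \<Sum>r\<in>trees (n - i). f (Node True l r) + f (Node False l r))"
    by (simp add: sum.Sigma[symmetric] g_def UNIV_bool add.commute sum.cartesian_product' case_prod_beta)
  finally show ?thesis by (simp add: L_def)
qed

text \<open>The probability that the critical Galton--Watson tree equals the given tree: a vertex is
  a leaf or a node with probability 1/2 each, and node signs are independent.\<close>

fun gw_weight :: "real \<Rightarrow> stree \<Rightarrow> real" where
  "gw_weight p Leaf = 1/2"
| "gw_weight p (Node s l r) = (if s then p else 1 - p) / 2 * gw_weight p l * gw_weight p r"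

text \<open>The expectation of \<open>f T\<close> on the event that the Galton--Watson tree
  \<open>T\<close> has \<open>n\<close> leaves.\<close>

definition wsum :: "real \<Rightarrow> nat \<Rightarrow> (stree \<Rightarrow> real) \<Rightarrow> real" where
  "wsum p n f = (\<Sum>t\<in>trees n. gw_weight p t * f t)"

lemma wsum_0 [simp]: "wsum p 0 f = 0"
  by (simp add: wsum_def)

lemma wsum_rec:
  "wsum p n f = (if n = 1 then f Leaf / 2 else 0) +
    (\<Sum>i\<le>n. wsum p i (\<lambda>l. wsum p (n - i) (\<lambda>r. p * f (Node True l r) + (1 - p) * f (Node False l r)))) / 2"
proof -
  have "(\<Sum>l\<in>trees i. \<Sum>r\<in>trees (n - i). gw_weight p (Node True l r) * f (Node True l r) +
            gw_weight p (Node False l r) * f (Node False l r)) =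
        wsum p i (\<lambda>l. wsum p (n - i) (\<lambda>r. p * f (Node True l r) + (1 - p) * f (Node False l r))) / 2" for i
    unfolding wsum_def sum_distrib_left sum_divide_distrib
    by (intro sum.cong refl) (simp add: field_simps)
  then show ?thesis
    unfolding wsum_def[of p n] sum_trees[of _ n] sum_divide_distrib
    by (simp only: gw_weight.simps(1)) simp
qed

text \<open>One entry per leaf: the leaf is removed and its parent contracted. A list rather than a
  set, since different leaves may give the same tree and Remy's identity counts multiplicities. The
  one-leaf tree has no entry.\<close>

fun dels :: "stree \<Rightarrow> stree list" where
  "dels Leaf = []"
| "dels (Node s l r) =
     (if l = Leaf then [r] else map (\<lambda>l'. Node s l' r) (dels l)) @
     (if r = Leaf then [l] else map (\<lambda>r'. Node s l r') (dels r))"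

lemma length_dels: "t \<noteq> Leaf \<Longrightarrow> length (dels t) = nleaves t"
  by (induction t) auto

lemma lis_dels: "t' \<in> set (dels t) \<Longrightarrow> lis t' \<le> lis t"
proof (induction t arbitrary: t')
  case (Node s l r)
  consider "t' = r" | "t' = l" | l' where "l' \<in> set (dels l)" "t' = Node s l' r"
    | r' where "r' \<in> set (dels r)" "t' = Node s l r'"
    using Node.prems by (auto split: if_splits)
  then show ?case
    using Node.IH by cases (fastforce simp: max_def)+
qed simp

section \<open>Linearity of the weighted sums and Remy's identity\<close>

lemma wsum_add: "wsum p n (\<lambda>t. f t + g t) = wsum p n f + wsum p n g"
  by (simp add: wsum_def distrib_left sum.distrib)

lemma wsum_cmult: "wsum p n (\<lambda>t. c * f t) = c * wsum p n f"
  by (simp add: wsum_def sum_distrib_left algebra_simps)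

lemma wsum_swap: "wsum p n (\<lambda>l. wsum p k (\<lambda>r. f l r)) = wsum p k (\<lambda>r. wsum p n (\<lambda>l. f l r))"
  by (simp add: wsum_def sum_distrib_left mult.left_commute sum.swap[of _ "trees k"])

lemma wsum_is_Leaf: "wsum p n (\<lambda>t. of_bool (t = Leaf)) = (if n = 1 then 1/2 else 0)"
  by (subst wsum_rec) (simp add: wsum_def)

lemma wsum_product: "wsum p n (\<lambda>l. wsum p k (\<lambda>r. f l * g r)) = wsum p n f * wsum p k g"
  unfolding wsum_cmult by (simp add: wsum_def sum_distrib_right mult.assoc)

definition sum_dels :: "(stree \<Rightarrow> real) \<Rightarrow> stree \<Rightarrow> real" where
  "sum_dels f t = sum_list (map f (dels t))"

lemma sum_dels_lin: "sum_dels (\<lambda>t. a * f t + b * g t) t = a * sum_dels f t + b * sum_dels g t"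
  unfolding sum_dels_def by (induction "dels t") (auto simp: sum_list_addf sum_list_const_mult)

lemma sum_dels_Node:
  "sum_dels f (Node s l r) =
     (of_bool (l = Leaf) * f r + sum_dels (\<lambda>l'. f (Node s l' r)) l) +
     (of_bool (r = Leaf) * f l + sum_dels (\<lambda>r'. f (Node s l r')) r)"
  by (auto simp: sum_dels_def o_def)

text \<open>Remy's identity: every tree with \<open>n + 1\<close> leaves arises by inserting a leaf in \<open>n + 1\<close> ways,
  every tree with \<open>n\<close> leaves has \<open>2 (2 n - 1)\<close> insertions, and an insertion costs a factor \<open>1/4\<close>
  in weight.\<close>
lemma wsum_sum_dels: "wsum p (Suc n) (sum_dels f) = (2 * real n - 1) / 2 * wsum p n f"
proof (induction n arbitrary: f rule: less_induct)
  case (less n)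
  \<comment> \<open>The sign of the root is averaged out, so that only the two subtrees remain to be
    summed over.\<close>
  define g where "g = (\<lambda>l r. p * f (Node True l r) + (1 - p) * f (Node False l r))"
  define h where "h = (\<lambda>j. wsum p j (\<lambda>l. wsum p (n - j) (g l)))"
  have node: "p * sum_dels f (Node True l r) + (1 - p) * sum_dels f (Node False l r) =
     (of_bool (l = Leaf) * f r + sum_dels (\<lambda>l'. g l' r) l) +
     (f l * of_bool (r = Leaf) + sum_dels (g l) r)" for l r
    unfolding g_def sum_dels_lin sum_dels_Node by (simp add: algebra_simps)
  \<comment> \<open>Deletions split into four kinds: the left child of the root is the deleted leaf
    (\<open>A\<close>), the leaf lies deeper on the left (\<open>B\<close>), and the same on the
    right (\<open>C\<close> and \<open>D\<close>).\<close>
  have A: "(\<Sum>i\<le>Suc n. wsum p i (\<lambda>l. wsum p (Suc n - i) (\<lambda>r. of_bool (l = Leaf) * f r))) = wsum p n f / 2"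
  proof -
    have "(\<Sum>i\<le>Suc n. wsum p i (\<lambda>l. wsum p (Suc n - i) (\<lambda>r. of_bool (l = Leaf) * f r))) =
          (\<Sum>i\<le>Suc n. if i = 1 then wsum p n f / 2 else 0)"
      unfolding wsum_product wsum_is_Leaf by (intro sum.cong) auto
    then show ?thesis by simp
  qed
  have C: "(\<Sum>i\<le>Suc n. wsum p i (\<lambda>l. wsum p (Suc n - i) (\<lambda>r. f l * of_bool (r = Leaf)))) = wsum p n f / 2"
  proof -
    have "(\<Sum>i\<le>Suc n. wsum p i (\<lambda>l. wsum p (Suc n - i) (\<lambda>r. f l * of_bool (r = Leaf)))) =
          (\<Sum>i\<le>Suc n. if i = n then wsum p n f / 2 else 0)"
      unfolding wsum_product wsum_is_Leaf by (intro sum.cong) auto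
    then show ?thesis by simp
  qed
  have B: "(\<Sum>i\<le>Suc n. wsum p i (\<lambda>l. wsum p (Suc n - i) (\<lambda>r. sum_dels (\<lambda>l'. g l' r) l))) =
        (\<Sum>j\<le>n. (2 * real j - 1) / 2 * h j)"
  proof -
    have eq: "wsum p (Suc j) (\<lambda>l. wsum p (n - j) (\<lambda>r. sum_dels (\<lambda>l'. g l' r) l)) =
          (2 * real j - 1) / 2 * h j" if "j \<le> n" for j
    \<comment> \<open>The induction hypothesis covers only \<open>j < n\<close>; for
      \<open>j = n\<close> the right subtree would have no leaves and both sides vanish.\<close>
    proof (cases "j = n")
      case True
      then show ?thesis by (simp add: h_def wsum_def)
    next
      case False
      with that have "j < n" by simp
      then have "wsum p (n - j) (\<lambda>r. wsum p (Suc j) (sum_dels (\<lambda>l'. g l' r))) =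
            wsum p (n - j) (\<lambda>r. (2 * real j - 1) / 2 * wsum p j (\<lambda>l'. g l' r))"
        by (simp only: less)
      then show ?thesis
        unfolding h_def wsum_swap[of p _ "n - j"] wsum_cmult by simp
    qed
    show ?thesis
      by (subst sum.atMost_Suc_shift, simp only: wsum_0 diff_Suc_Suc add_0_left, intro sum.cong refl eq) simp
  qed
  have D: "(\<Sum>i\<le>Suc n. wsum p i (\<lambda>l. wsum p (Suc n - i) (sum_dels (g l)))) =
        (\<Sum>j\<le>n. (2 * real (n - j) - 1) / 2 * h j)"
  proof -
    have eq: "wsum p i (\<lambda>l. wsum p (Suc n - i) (sum_dels (g l))) =
          (2 * real (n - i) - 1) / 2 * h i" if "i \<le> n" for i
    proof (cases "i = 0")
      case False
      with that have "n - i < n" "Suc n - i = Suc (n - i)" by auto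
      then show ?thesis
        using less[of "n - i"] unfolding h_def wsum_cmult[symmetric] by simp
    qed (simp add: h_def)
    have "wsum p (Suc n) (\<lambda>l. wsum p (Suc n - Suc n) (sum_dels (g l))) = 0"
      by (simp add: wsum_def)
    then show ?thesis
      by (simp only: sum.atMost_Suc add_0_right) (intro sum.cong refl eq, simp)
  qed
  have sumh: "(\<Sum>j\<le>n. h j) = 2 * (wsum p n f - (if n = 1 then f Leaf / 2 else 0))"
    unfolding h_def g_def by (subst (3) wsum_rec) simp
  \<comment> \<open>The two coefficients of \<open>h j\<close> add up to \<open>n - 1\<close> for
    every \<open>j\<close>, so only the total of \<open>h\<close> matters, and that is known from
    \<open>wsum_rec\<close>.\<close>
  have "(\<Sum>j\<le>n. (2 * real j - 1) / 2 * h j) + (\<Sum>j\<le>n. (2 * real (n - j) - 1) / 2 * h j) =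
      (real n - 1) * (\<Sum>j\<le>n. h j)"
    unfolding sum.distrib[symmetric] sum_distrib_left
    by (intro sum.cong) (auto simp: field_simps of_nat_diff)
  also have "\<dots> = 2 * (real n - 1) * wsum p n f"
    unfolding sumh by auto
  finally have BD: "(\<Sum>j\<le>n. (2 * real j - 1) / 2 * h j) + (\<Sum>j\<le>n. (2 * real (n - j) - 1) / 2 * h j) =
      2 * (real n - 1) * wsum p n f" .
  have "wsum p (Suc n) (sum_dels f) =
     (\<Sum>i\<le>Suc n. wsum p i (\<lambda>l. wsum p (Suc n - i)
        (\<lambda>r. p * sum_dels f (Node True l r) + (1 - p) * sum_dels f (Node False l r)))) / 2"
    by (subst wsum_rec) (simp add: sum_dels_def)
  also have "\<dots> = (wsum p n f / 2 + (\<Sum>j\<le>n. (2 * real j - 1) / 2 * h j) +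
     (wsum p n f / 2 + (\<Sum>j\<le>n. (2 * real (n - j) - 1) / 2 * h j))) / 2"
    unfolding node wsum_add sum.distrib A B C D ..
  also have "\<dots> = (2 * real n - 1) / 2 * wsum p n f"
  proof -
    have "(a / 2 + x + (a / 2 + y)) / 2 = (2 * real n - 1) / 2 * a"
      if "x + y = 2 * (real n - 1) * a" for a x y :: real
    proof -
      have "(a / 2 + x + (a / 2 + y)) / 2 = (a + (x + y)) / 2" by simp
      then show ?thesis unfolding that by (simp add: algebra_simps)
    qed
    from this[OF BD] show ?thesis .
  qed
  finally show ?case .
qed

context
  fixes p :: real
  assumes p: "0 < p" "p < 1"
begin

lemma gw_weight_pos: "gw_weight p t > 0"
  using p by (induction t) auto

lemma wsum_mono: "(\<And>t. t \<in> trees n \<Longrightarrow> f t \<le> g t) \<Longrightarrow> wsum p n f \<le> wsum p n g"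
  unfolding wsum_def by (intro sum_mono mult_left_mono) (auto intro: less_imp_le gw_weight_pos)

lemma wsum_nonneg: "(\<And>t. f t \<ge> 0) \<Longrightarrow> wsum p n f \<ge> 0"
  unfolding wsum_def by (intro sum_nonneg mult_nonneg_nonneg) (auto intro: less_imp_le gw_weight_pos)

end

lemma trees_not_Leaf: "t \<in> trees (Suc n) \<Longrightarrow> n \<ge> 1 \<Longrightarrow> t \<noteq> Leaf"
  by (auto simp: trees_def)

text \<open>Remy's identity for a constant function: a tree with \<open>n + 1\<close> leaves has
  exactly \<open>n + 1\<close> deletions. This is the recursion of the Catalan numbers.\<close>

lemma wsum_one_Suc:
  assumes "n \<ge> 1"
  shows "real (n + 1) * wsum p (Suc n) (\<lambda>_. 1) = (2 * real n - 1) / 2 * wsum p n (\<lambda>_. 1)"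
proof -
  have "wsum p (Suc n) (sum_dels (\<lambda>_. 1)) = wsum p (Suc n) (\<lambda>_. real (n + 1) * 1)"
    unfolding wsum_def sum_dels_def using assms
    by (intro sum.cong refl)
       (auto simp: length_dels trees_not_Leaf map_replicate_const sum_list_replicate trees_def)
  then show ?thesis
    unfolding wsum_sum_dels wsum_cmult by simp
qed

text \<open>Together with \<open>wsum_one_Suc\<close> this says that the mean of such an
  \<open>f\<close> over trees with \<open>n\<close> leaves is nondecreasing in
  \<open>n\<close>.\<close>

lemma wsum_mono_fun_Suc:
  assumes p: "0 < p" "p < 1" and n: "n \<ge> 1" and f: "\<And>t t'. t' \<in> set (dels t) \<Longrightarrow> f t' \<le> f t"
  shows "(2 * real n - 1) / 2 * wsum p n f \<le> real (n + 1) * wsum p (Suc n) f"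
proof -
  have "sum_dels f t \<le> real (n + 1) * f t" if t: "t \<in> trees (Suc n)" for t
  proof -
    have "sum_dels f t \<le> sum_list (map (\<lambda>_. f t) (dels t))"
      unfolding sum_dels_def by (intro sum_list_mono f)
    also have "\<dots> = real (n + 1) * f t"
      using length_dels[OF trees_not_Leaf[OF t n]] t
      by (auto simp: map_replicate_const sum_list_replicate trees_def algebra_simps)
    finally show ?thesis .
  qed
  then have "wsum p (Suc n) (sum_dels f) \<le> wsum p (Suc n) (\<lambda>t. real (n + 1) * f t)"
    by (intro wsum_mono[OF p])
  then show ?thesis
    unfolding wsum_sum_dels wsum_cmult .
qed

text \<open>The product is the central binomial coefficient of \<open>2 n\<close> over
  \<open>4 ^ n\<close>. By \<open>wsum_one_sums_tail\<close> it is the probability that the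
  Galton--Watson tree has more than \<open>n\<close> leaves.\<close>

definition gw_tail :: "nat \<Rightarrow> real" where
  "gw_tail n = (\<Prod>k=1..n. (2 * real k - 1) / (2 * real k))"

lemma gw_tail_0 [simp]: "gw_tail 0 = 1"
  by (simp add: gw_tail_def)

lemma gw_tail_Suc: "gw_tail (Suc n) = gw_tail n * ((2 * real n + 1) / (2 * real n + 2))"
  by (simp add: gw_tail_def algebra_simps)

lemma gw_tail_pos: "gw_tail n > 0"
  by (induction n) (auto simp: gw_tail_Suc)

text \<open>A Wallis estimate: the left side decreases in \<open>n\<close>, since
  \<open>(2 n + 1) (2 n + 3)\<close> is at most the square of \<open>2 n + 2\<close>. The opposite
  estimate \<open>gw_tail_sq_ge\<close> uses an increasing product in the same way.\<close>

lemma gw_tail_sq_le: "(gw_tail n)\<^sup>2 * (2 * real n + 1) \<le> 1"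
proof (induction n)
  case (Suc n)
  have "(gw_tail (Suc n))\<^sup>2 * (2 * real (Suc n) + 1) =
    (gw_tail n)\<^sup>2 * (2 * real n + 1) * ((2 * real n + 1) * (2 * real n + 3) / (2 * real n + 2)\<^sup>2)"
    by (simp add: gw_tail_Suc power2_eq_square)
  also have "\<dots> \<le> 1 * 1"
  proof (intro mult_mono Suc)
    show "(2 * real n + 1) * (2 * real n + 3) / (2 * real n + 2)\<^sup>2 \<le> 1"
      by (subst divide_le_eq_1_pos) (auto simp: power2_eq_square algebra_simps add_pos_nonneg)
  qed auto
  finally show ?case by simp
qed simp

lemma gw_tail_sq_ge: "n \<ge> 1 \<Longrightarrow> (gw_tail n)\<^sup>2 * (4 * real n) \<ge> 1"
proof (induction n rule: dec_induct)
  case base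
  show ?case by (simp add: gw_tail_def power2_eq_square)
next
  case (step n)
  then have "1 * 1 \<le> (gw_tail n)\<^sup>2 * (4 * real n) * ((2 * real n + 1)\<^sup>2 / (4 * real n * (real n + 1)))"
  proof (intro mult_mono)
    show "1 \<le> (2 * real n + 1)\<^sup>2 / (4 * real n * (real n + 1))"
      using step.hyps by (subst le_divide_eq_1_pos) (auto simp: power2_eq_square algebra_simps add_pos_nonneg)
  qed auto
  also have "\<dots> = (gw_tail (Suc n))\<^sup>2 * (4 * real (Suc n))"
    using step.hyps by (simp add: gw_tail_Suc power2_eq_square divide_simps) (simp add: algebra_simps)
  finally show ?case by simp
qed

lemma gw_tail_ge: "gw_tail n \<ge> 1 / (2 * sqrt (real (Suc n)))"
proof (rule power2_le_imp_le)
  have "1 / (4 * real (Suc n)) \<le> (gw_tail n)\<^sup>2"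
  proof (cases "n = 0")
    case False
    then have "1 \<le> (gw_tail n)\<^sup>2 * (4 * real n)" by (intro gw_tail_sq_ge) simp
    also have "\<dots> \<le> (gw_tail n)\<^sup>2 * (4 * real (Suc n))" by (intro mult_left_mono) auto
    finally show ?thesis by (simp add: divide_simps)
  qed simp
  then show "(1 / (2 * sqrt (real (Suc n))))\<^sup>2 \<le> (gw_tail n)\<^sup>2"
    by (simp add: power_divide power_mult_distrib)
qed (use gw_tail_pos[of n] in auto)

lemma gw_tail_tendsto_0: "gw_tail \<longlonglongrightarrow> 0"
proof -
  have "(\<lambda>n. (gw_tail n)\<^sup>2) \<longlonglongrightarrow> 0"
  proof (rule tendsto_sandwich[of "\<lambda>_. 0" _ _ "\<lambda>n. 1 / (real n + 1)"])
    show "\<forall>\<^sub>F n in sequentially. (gw_tail n)\<^sup>2 \<le> 1 / (real n + 1)"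
    proof (rule always_eventually, rule allI)
      fix n
      have "(gw_tail n)\<^sup>2 * (real n + 1) \<le> (gw_tail n)\<^sup>2 * (2 * real n + 1)"
        by (intro mult_left_mono) auto
      also note gw_tail_sq_le
      finally show "(gw_tail n)\<^sup>2 \<le> 1 / (real n + 1)" by (simp add: divide_simps)
    qed
    show "(\<lambda>n. 1 / (real n + 1)) \<longlonglongrightarrow> 0"
      using LIMSEQ_inverse_real_of_nat by (simp add: inverse_eq_divide add.commute)
  qed auto
  then show ?thesis
    by (simp add: power_tendsto_0_iff)
qed

lemma wsum_one_eq: "wsum p (Suc n) (\<lambda>_. 1) = gw_tail n / (2 * (real n + 1))"
proof (induction n)
  case 0
  show ?case by (subst wsum_rec) (simp add: wsum_def)
next
  case (Suc n)
  have "(real n + 2) * wsum p (Suc (Suc n)) (\<lambda>_. 1) = (2 * real n + 1) / 2 * (gw_tail n / (2 * (real n + 1)))"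
    using wsum_one_Suc[of "Suc n" p] unfolding Suc by (simp add: algebra_simps)
  then have "wsum p (Suc (Suc n)) (\<lambda>_. 1) = (2 * real n + 1) / 2 * (gw_tail n / (2 * (real n + 1))) / (real n + 2)"
    by (subst nonzero_eq_divide_eq) (auto simp: mult.commute)
  then show ?case by (simp add: gw_tail_Suc divide_simps) (simp add: algebra_simps)
qed

text \<open>The leaf-count probabilities are decrements of a sequence tending to 0, so their sums
  telescope and the total mass is 1.\<close>

lemma wsum_one_diff: "wsum p (Suc n) (\<lambda>_. 1) = gw_tail n - gw_tail (Suc n)"
  unfolding wsum_one_eq gw_tail_Suc by (simp add: divide_simps) (simp add: algebra_simps)

lemma wsum_one_sums_tail: "(\<lambda>k. wsum p (Suc (k + n)) (\<lambda>_. 1)) sums gw_tail n"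
proof -
  have "(\<lambda>k. gw_tail (k + n)) \<longlonglongrightarrow> 0"
    by (rule LIMSEQ_ignore_initial_segment[OF gw_tail_tendsto_0])
  from telescope_sums'[OF this] show ?thesis
    by (simp add: wsum_one_diff)
qed

lemma wsum_one_sums: "(\<lambda>n. wsum p n (\<lambda>_. 1)) sums 1"
  using wsum_one_sums_tail[of p 0] sums_Suc_iff[of "\<lambda>n. wsum p n (\<lambda>_. 1)" 1] by simp

text \<open>The true order is \<open>n powr (- 3/2)\<close>. The cruder bound suffices, since in
  \<open>lis_lower_deviation\<close> it is set against a stretched exponential.\<close>

lemma wsum_one_ge: 
  assumes "n \<ge> 1"
  shows "wsum p n (\<lambda>_. 1) \<ge> 1 / (4 * (real n)\<^sup>2)"
proof -
  obtain k where n: "n = Suc k" using assms by (cases n) auto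
  have "sqrt (real n) \<le> real n"
    using assms by (simp add: real_sqrt_le_iff' real_le_lsqrt power2_eq_square)
  then have "1 / (2 * real n) \<le> 1 / (2 * sqrt (real n))"
    using assms by (intro divide_left_mono) auto
  also have "\<dots> \<le> gw_tail k"
    using gw_tail_ge[of k] n by simp
  finally have "1 / (2 * real n) / (2 * real n) \<le> gw_tail k / (2 * real n)"
    by (rule divide_right_mono) simp
  moreover have "1 / (4 * (real n)\<^sup>2) = 1 / (2 * real n) / (2 * real n)"
    by (simp add: power2_eq_square)
  moreover have "wsum p n (\<lambda>_. 1) = gw_tail k / (2 * real n)"
    by (simp add: n wsum_one_eq add.commute)
  ultimately show ?thesis by simp
qed

section \<open>The functional equation\<close>

definition low_weight :: "real \<Rightarrow> nat \<Rightarrow> nat \<Rightarrow> real" where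
  "low_weight p m n = wsum p n (\<lambda>t. of_bool (lis t < m))"

text \<open>Because the inequality in \<open>low_weight\<close> is strict,
  \<open>1 - lis_cdf p m\<close> is the tail \<open>G m\<close> of the overview.\<close>

definition lis_cdf :: "real \<Rightarrow> nat \<Rightarrow> real" where
  "lis_cdf p m = (\<Sum>n. low_weight p m n)"

text \<open>The weight of pairs of trees with \<open>n\<close> leaves in total whose values of \<open>lis\<close>
  are below \<open>m\<close>, but whose sum is not.\<close>
definition cross_weight :: "real \<Rightarrow> nat \<Rightarrow> nat \<Rightarrow> real" where
  "cross_weight p m n = (\<Sum>i\<le>n. low_weight p m i * low_weight p m (n - i)) -
     (\<Sum>x<m. \<Sum>i\<le>n. (low_weight p (Suc x) i - low_weight p x i) * low_weight p (m - x) (n - i))"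

lemma low_weight_diff: "low_weight p (Suc x) i - low_weight p x i = wsum p i (\<lambda>t. of_bool (lis t = x))"
proof -
  have "wsum p i (\<lambda>t. of_bool (lis t < Suc x)) =
     wsum p i (\<lambda>t. of_bool (lis t < x) + of_bool (lis t = x))"
    by (intro arg_cong[of _ _ "wsum p i"]) (auto simp: less_Suc_eq)
  then show ?thesis by (simp add: low_weight_def wsum_add)
qed

text \<open>Fixing the first summand turns the event into a sum of products, which
  \<open>wsum_product\<close> factorizes.\<close>

lemma of_bool_add_less:
  "of_bool (a + b < m) = (\<Sum>x<m. of_bool (a = x) * of_bool (b < m - x) :: real)" for a b m :: nat
proof -
  have "(\<Sum>x<m. of_bool (a = x) * of_bool (b < m - x) :: real) = (\<Sum>x<m. if x = a then of_bool (b < m - a) else 0)"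
    by (intro sum.cong) auto
  also have "\<dots> = of_bool (a + b < m)" by (auto simp: sum.delta)
  finally show ?thesis by simp
qed

lemma wsum_sum: "wsum p n (\<lambda>t. \<Sum>x\<in>X. f x t) = (\<Sum>x\<in>X. wsum p n (f x))"
  by (simp add: wsum_def sum_distrib_left sum.swap[of _ X])

lemma wsum_pair_add:
  "wsum p i (\<lambda>l. wsum p k (\<lambda>r. a * f l r + b * g l r)) =
     a * wsum p i (\<lambda>l. wsum p k (f l)) + b * wsum p i (\<lambda>l. wsum p k (g l))"
  by (simp only: wsum_add wsum_cmult)

text \<open>For either sign of the root both subtrees must stay below \<open>m\<close>; a plus root,
  which has probability \<open>p\<close>, excludes in addition the pairs counted by
  \<open>cross_weight\<close>. For \<open>m\<close> at least 2 the one-leaf tree qualifies, whence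
  the first term.\<close>

lemma low_weight_rec:
  assumes "m \<ge> 2"
  shows "low_weight p m n = of_bool (n = 1) / 2 +
    (\<Sum>i\<le>n. low_weight p m i * low_weight p m (n - i)) / 2 - p / 2 * cross_weight p m n"
proof -
  have node: "p * of_bool (lis (Node True l r) < m) + (1 - p) * of_bool (lis (Node False l r) < m) =
     p * (\<Sum>x<m. of_bool (lis l = x) * of_bool (lis r < m - x)) +
     (1 - p) * (of_bool (lis l < m) * of_bool (lis r < m))" for l r
    unfolding of_bool_add_less[symmetric] by auto
  have "low_weight p m n = of_bool (n = 1) / 2 +
    (\<Sum>i\<le>n. p * (\<Sum>x<m. (low_weight p (Suc x) i - low_weight p x i) * low_weight p (m - x) (n - i))
        + (1 - p) * (low_weight p m i * low_weight p m (n - i))) / 2"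
    using assms unfolding low_weight_diff unfolding low_weight_def
    by (subst wsum_rec, unfold node wsum_pair_add wsum_sum wsum_product) simp
  also have "(\<Sum>i\<le>n. p * (\<Sum>x<m. (low_weight p (Suc x) i - low_weight p x i) * low_weight p (m - x) (n - i))
        + (1 - p) * (low_weight p m i * low_weight p m (n - i))) =
     (\<Sum>i\<le>n. low_weight p m i * low_weight p m (n - i)) - p * cross_weight p m n"
    unfolding cross_weight_def sum.distrib sum_distrib_left[symmetric] sum.swap[of _ "{..n}" "{..<m}"]
    by (simp add: algebra_simps)
  finally show ?thesis by (simp add: field_simps)
qed

section \<open>Summation over the number of leaves\<close>

context
  fixes p :: real
  assumes p: "0 < p" "p < 1"
begin

lemma low_weight_nonneg: "low_weight p m n \<ge> 0"
  unfolding low_weight_def by (intro wsum_nonneg[OF p]) auto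

lemma low_weight_mono: "m \<le> m' \<Longrightarrow> low_weight p m n \<le> low_weight p m' n"
  unfolding low_weight_def by (intro wsum_mono[OF p]) auto

lemma low_weight_le_one: "low_weight p m n \<le> wsum p n (\<lambda>_. 1)"
  unfolding low_weight_def by (intro wsum_mono[OF p]) auto

lemma summable_low_weight: "summable (low_weight p m)"
  by (rule summable_comparison_test[OF _ sums_summable[OF wsum_one_sums[of p]]])
     (auto simp: low_weight_nonneg low_weight_le_one)

lemma low_weight_sums: "low_weight p m sums lis_cdf p m"
  using summable_low_weight by (simp add: lis_cdf_def summable_sums)

lemma low_weight_0 [simp]: "low_weight p 0 n = 0" and low_weight_1 [simp]: "low_weight p (Suc 0) n = 0"
  using lis_pos by (auto simp: low_weight_def wsum_def Suc_le_eq not_less_eq_eq intro!: sum.neutral simp flip: neq0_conv)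

lemma lis_cdf_0 [simp]: "lis_cdf p 0 = 0" and lis_cdf_1 [simp]: "lis_cdf p (Suc 0) = 0"
  by (auto simp: lis_cdf_def)

lemma lis_cdf_mono: "m \<le> m' \<Longrightarrow> lis_cdf p m \<le> lis_cdf p m'"
  unfolding lis_cdf_def by (intro suminf_le low_weight_mono summable_low_weight)

lemma lis_cdf_le_1: "lis_cdf p m \<le> 1"
  using suminf_le[OF low_weight_le_one summable_low_weight sums_summable[OF wsum_one_sums]]
  by (simp add: lis_cdf_def sums_unique[OF wsum_one_sums, symmetric])

text \<open>Raising \<open>m - x\<close> to \<open>m\<close> can only increase the subtracted sum,
  which then telescopes to the first sum.\<close>

lemma cross_weight_nonneg: "cross_weight p m n \<ge> 0"
proof -
  have "(\<Sum>x<m. \<Sum>i\<le>n. (low_weight p (Suc x) i - low_weight p x i) * low_weight p (m - x) (n - i)) \<le>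
        (\<Sum>x<m. \<Sum>i\<le>n. (low_weight p (Suc x) i - low_weight p x i) * low_weight p m (n - i))"
    by (intro sum_mono mult_left_mono low_weight_mono) (auto simp: low_weight_mono)
  also have "\<dots> = (\<Sum>i\<le>n. low_weight p m i * low_weight p m (n - i))"
  proof -
    have "(\<Sum>x<m. low_weight p (Suc x) i - low_weight p x i) = low_weight p m i" for i
      using sum_lessThan_telescope[of "\<lambda>x. low_weight p x i" m] by simp
    then show ?thesis
      by (subst sum.swap) (simp add: sum_distrib_right[symmetric])
  qed
  finally show ?thesis by (simp add: cross_weight_def)
qed

lemma low_weight_product_sums:
  "(\<lambda>n. \<Sum>i\<le>n. low_weight p a i * low_weight p b (n - i)) sums (lis_cdf p a * lis_cdf p b)"
  using Cauchy_product_sums[of "low_weight p a" "low_weight p b"] summable_low_weight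
  by (simp add: lis_cdf_def low_weight_nonneg)

lemma cross_weight_sums:
  "cross_weight p m sums
     ((lis_cdf p m)\<^sup>2 - (\<Sum>x<m. (lis_cdf p (Suc x) - lis_cdf p x) * lis_cdf p (m - x)))"
  unfolding cross_weight_def power2_eq_square left_diff_distrib sum_subtractf
  by (intro sums_diff sums_sum low_weight_product_sums)

text \<open>With \<open>F = lis_cdf p m\<close> and total cross weight \<open>C\<close>, summing
  \<open>low_weight_rec\<close> over \<open>n\<close> gives
  \<open>2 * F = 1 + F^2 - p * C\<close>.\<close>

lemma cross_weight_sums':
  assumes "m \<ge> 2"
  shows "(\<lambda>n. p * cross_weight p m n) sums (1 - lis_cdf p m)\<^sup>2"
proof -
  have "(\<lambda>n. of_bool (n = 1) + (\<Sum>i\<le>n. low_weight p m i * low_weight p m (n - i)) - 2 * low_weight p m n)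
      sums (1 + lis_cdf p m * lis_cdf p m - 2 * lis_cdf p m)"
    by (intro sums_diff sums_add low_weight_product_sums sums_mult low_weight_sums)
       (use sums_single[of 1 "\<lambda>_. 1::real"] in \<open>simp add: of_bool_def\<close>)
  moreover have "of_bool (n = 1) + (\<Sum>i\<le>n. low_weight p m i * low_weight p m (n - i)) - 2 * low_weight p m n
     = p * cross_weight p m n" for n
    unfolding low_weight_rec[OF assms, of p n] by simp
  ultimately show ?thesis
    by (simp add: power2_eq_square algebra_simps)
qed

lemma lis_cdf_rec:
  assumes "m \<ge> 2"
  shows "p * ((lis_cdf p m)\<^sup>2 - (\<Sum>x<m. (lis_cdf p (Suc x) - lis_cdf p x) * lis_cdf p (m - x))) =
    (1 - lis_cdf p m)\<^sup>2"
  using sums_unique2[OF sums_mult[OF cross_weight_sums, of p m] cross_weight_sums'[OF assms]] .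

text \<open>A continuity argument for the generating function \<open>S\<close>: if it reached 1 at
  some \<open>z\<close> beyond 1, the recursion would force \<open>z\<close> to be at least 1 plus
  the collected cross weight, which takes \<open>z\<close> past \<open>1 + g / 2\<close>. So
  \<open>S\<close> stays below 1 up to there, and so does each of its terms.\<close>

lemma low_weight_exp_bound:
  assumes m: "m \<ge> 2" and G: "lis_cdf p m < 1"
  shows "low_weight p m n * (1 + (1 - lis_cdf p m)\<^sup>2 / 2) ^ n \<le> 1"
proof -
  define g where "g = (1 - lis_cdf p m)\<^sup>2"
  have g: "g > 0" using G by (simp add: g_def)
  let ?a = "low_weight p m"
  have "(\<lambda>N. \<Sum>k<N. p * cross_weight p m k) \<longlonglongrightarrow> g"
    using cross_weight_sums'[OF m] by (simp add: sums_def g_def)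
  then have "\<forall>\<^sub>F N in sequentially. (\<Sum>k<N. p * cross_weight p m k) > g / 2"
    using g by (intro order_tendstoD) auto
  then obtain N0 where N0: "\<And>N. N \<ge> N0 \<Longrightarrow> (\<Sum>k<N. p * cross_weight p m k) > g / 2"
    by (auto simp: eventually_sequentially)
  \<comment> \<open>Truncation at \<open>N\<close> makes \<open>S\<close> a polynomial.
    \<open>N\<close> is large enough for the cross weights up to \<open>N\<close> to exceed
    \<open>g / 2\<close> and for the indices \<open>n\<close> and 1 to occur.\<close>
  define N where "N = max N0 (Suc n)"
  define S where "S = (\<lambda>z. \<Sum>k\<le>N. ?a k * z ^ k)"
  have cross: "(\<Sum>k\<le>N. p * cross_weight p m k) > g / 2"
    using N0[of "Suc N"] unfolding lessThan_Suc_atMost by (simp add: N_def)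
  have S_le: "S z \<le> z / 2 + (S z)\<^sup>2 / 2 - (\<Sum>k\<le>N. p * cross_weight p m k) / 2" if z: "z \<ge> 1" for z
  proof -
    have "(\<Sum>k\<le>N. (\<Sum>i\<le>k. ?a i * ?a (k - i)) * z ^ k) = (\<Sum>k\<le>N. \<Sum>i\<le>k. (?a i * z ^ i) * (?a (k - i) * z ^ (k - i)))"
      unfolding sum_distrib_right
      by (intro sum.cong refl) (simp add: power_add[symmetric] mult_ac)
    also have "\<dots> = (\<Sum>(i,j)\<in>{(i,j). i + j \<le> N}. (?a i * z ^ i) * (?a j * z ^ j))"
      by (rule sum.triangle_reindex_eq[symmetric])
    \<comment> \<open>Completing the triangle to a square is the cost of truncation; all terms are
      nonnegative, so it goes in the required direction.\<close>
    also have "\<dots> \<le> (\<Sum>(i,j)\<in>{..N}\<times>{..N}. (?a i * z ^ i) * (?a j * z ^ j))"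
      using z by (intro sum_mono2) (auto simp: low_weight_nonneg)
    also have "\<dots> = (S z)\<^sup>2"
      unfolding S_def power2_eq_square sum_product sum.cartesian_product ..
    finally have sq: "(\<Sum>k\<le>N. (\<Sum>i\<le>k. ?a i * ?a (k - i)) * z ^ k) \<le> (S z)\<^sup>2" .
    have cr: "(\<Sum>k\<le>N. p * cross_weight p m k) \<le> (\<Sum>k\<le>N. p * cross_weight p m k * z ^ k)"
    proof (rule sum_mono)
      fix k
      have "p * cross_weight p m k * 1 \<le> p * cross_weight p m k * z ^ k"
        using z p cross_weight_nonneg by (intro mult_left_mono) (auto simp: one_le_power)
      then show "p * cross_weight p m k \<le> p * cross_weight p m k * z ^ k" by simp
    qed
    have lin: "(\<Sum>k\<le>N. of_bool (k = 1) * z ^ k) = z"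
    proof -
      have "(\<Sum>k\<le>N. of_bool (k = 1) * z ^ k) = (\<Sum>k\<le>N. if k = 1 then z else 0)"
        by (intro sum.cong) auto
      then show ?thesis by (simp add: N_def)
    qed
    have "S z = (\<Sum>k\<le>N. of_bool (k = 1) * z ^ k) / 2 + (\<Sum>k\<le>N. (\<Sum>i\<le>k. ?a i * ?a (k - i)) * z ^ k) / 2
         - (\<Sum>k\<le>N. p * cross_weight p m k * z ^ k) / 2"
      unfolding S_def sum_divide_distrib sum.distrib[symmetric] sum_subtractf[symmetric]
      by (intro sum.cong refl, subst low_weight_rec[OF m]) (simp add: field_simps)
    then show ?thesis
      unfolding lin using sq cr by linarith
  qed
  have S1: "S 1 < 1"
  proof -
    have "S 1 \<le> lis_cdf p m"
      unfolding S_def lis_cdf_def using sum_le_suminf[OF summable_low_weight, of "{..N}" m]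
      by (simp add: low_weight_nonneg)
    then show ?thesis using G by simp
  qed
  have "S (1 + g / 2) < 1"
  proof (rule ccontr)
    assume "\<not> S (1 + g / 2) < 1"
    moreover have "continuous_on {1..1 + g/2} S"
      unfolding S_def by (intro continuous_intros)
    ultimately obtain z where z: "1 \<le> z" "z \<le> 1 + g / 2" "S z = 1"
      using IVT'[of S 1 1 "1 + g/2"] S1 g by auto
    from S_le[OF z(1)] z cross show False by simp
  qed
  moreover have "?a n * (1 + g / 2) ^ n \<le> S (1 + g / 2)"
    unfolding S_def using g by (intro member_le_sum) (auto simp: N_def low_weight_nonneg)
  ultimately show ?thesis by (simp add: g_def)
qed

text \<open>\<open>gw_tail (n - 1)\<close> is the probability of at least \<open>n\<close> leaves.
  Leaf deletion makes the conditional probability of the event nondecreasing in the size, so for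
  every larger size it is at least its value at \<open>n\<close>; summing over these sizes gives a
  part of the full tail.\<close>

lemma high_weight_le:
  assumes n: "n \<ge> 1"
  shows "wsum p n (\<lambda>t. of_bool (lis t \<ge> m)) / wsum p n (\<lambda>_. 1) * gw_tail (n - 1) \<le> 1 - lis_cdf p m"
proof -
  let ?e = "\<lambda>n. wsum p n (\<lambda>t. of_bool (lis t \<ge> m))"
  let ?u = "\<lambda>n. wsum p n (\<lambda>_. 1)"
  have upos: "?u n > 0" if "n \<ge> 1" for n
    using that by (intro less_le_trans[OF _ wsum_one_ge]) auto
  have mono: "?e n / ?u n \<le> ?e (n + k) / ?u (n + k)" for k
  proof (induction k)
    case (Suc k)
    let ?N = "n + k"
    have N: "?N \<ge> 1" using n by simp
    \<comment> \<open>The factor by which the total weight changes when one leaf is added; it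
      cancels in the quotient.\<close>
    define c where "c = (2 * real ?N - 1) / 2 / real (?N + 1)"
    have c: "c > 0" using N by (simp add: c_def)
    have u: "?u (Suc ?N) = c * ?u ?N"
      using wsum_one_Suc[OF N, of p] by (simp add: c_def field_simps)
    have "c * ?e ?N \<le> ?e (Suc ?N)"
      using wsum_mono_fun_Suc[OF p N, of "\<lambda>t. of_bool (lis t \<ge> m)"] lis_dels
      by (force simp: c_def field_simps)
    then have "c * ?e ?N / (c * ?u ?N) \<le> ?e (Suc ?N) / ?u (Suc ?N)"
      unfolding u using c upos[OF N] by (intro divide_right_mono) auto
    then show ?case using Suc c by simp
  qed simp
  have e_eq: "?e k = ?u k - low_weight p m k" for k
  proof -
    have "wsum p k (\<lambda>_. 1) = wsum p k (\<lambda>t. of_bool (lis t \<ge> m) + of_bool (lis t < m))"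
      by (intro arg_cong[of _ _ "wsum p k"]) auto
    then show ?thesis by (simp add: wsum_add low_weight_def)
  qed
  have e_sums: "?e sums (1 - lis_cdf p m)"
    unfolding e_eq by (intro sums_diff wsum_one_sums low_weight_sums)
  have "?e n / ?u n * gw_tail (n - 1) \<le> 1 - lis_cdf p m - (\<Sum>i<n. ?e i)"
  proof (rule sums_le)
    show "(\<lambda>k. ?e (k + n)) sums (1 - lis_cdf p m - (\<Sum>i<n. ?e i))"
      by (rule sums_split_initial_segment[OF e_sums])
    show "(\<lambda>k. ?e n / ?u n * ?u (k + n)) sums (?e n / ?u n * gw_tail (n - 1))"
      using wsum_one_sums_tail[of p "n - 1"] n by (intro sums_mult) simp
    show "?e n / ?u n * ?u (k + n) \<le> ?e (k + n)" for k
    proof -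
      have "?u (k + n) > 0" using n by (intro upos) simp
      then show ?thesis using mono[of k] by (simp add: pos_le_divide_eq add.commute[of n])
    qed
  qed
  also have "\<dots> \<le> 1 - lis_cdf p m"
    using wsum_nonneg[OF p] by (simp add: sum_nonneg)
  finally show ?thesis .
qed

end

section \<open>The Beta integral\<close>

text \<open>\<open>1 + psi g\<close> is the limit in \<open>m\<close> of the convolution sum of
  \<open>i powr (- g)\<close> divided by \<open>m powr (- 2 * g)\<close>.\<close>

definition psi :: "real \<Rightarrow> real" where
  "psi g = (2 * g - 1) * Beta (1 - g) (1 - g)"

lemma Beta_real_pos: "a > 0 \<Longrightarrow> b > 0 \<Longrightarrow> Beta a b > (0::real)"
  by (simp add: Beta_def Gamma_real_pos)

lemma psi_strict_mono:
  assumes "1/2 < a" "a < b" "b < 1"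
  shows "psi a < psi b"
  unfolding psi_def
proof (rule mult_less_le_imp_less)
  show "Beta (1 - a) (1 - a) \<le> Beta (1 - b) (1 - b)"
    using assms by (intro Beta_real_mono) auto
qed (use assms Beta_real_pos[of "1 - a" "1 - a"] in auto)

text \<open>An explicit minorant that tends to infinity at 1, obtained by raising one argument of
  the Beta function to 1.\<close>

lemma psi_ge:
  assumes "1/2 \<le> g" "g < 1"
  shows "psi g \<ge> (2 * g - 1) / (1 - g)"
proof -
  have "1 - g \<notin> \<int>\<^sub>\<le>\<^sub>0"
    using assms by (auto elim!: nonpos_Ints_cases)
  then have "Beta (1 - g) 1 = 1 / (1 - g)"
    using Gamma_plus1[of "1 - g"] assms by (simp add: Beta_def Gamma_eq_zero_iff)
  moreover have "Beta (1 - g) 1 \<le> Beta (1 - g) (1 - g)"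
    using assms by (intro Beta_real_mono) auto
  ultimately show ?thesis
    using assms mult_left_mono[of "1 / (1 - g)" "Beta (1 - g) (1 - g)" "2 * g - 1"]
    by (simp add: psi_def)
qed

lemma psi_surj:
  assumes "c > 0"
  obtains g where "1/2 < g" "g < 1" "psi g = c"
proof -
  \<comment> \<open>The point where the minorant of \<open>psi_ge\<close> equals \<open>c\<close>;
    the intermediate value theorem is applied between \<open>1/2\<close> and
    \<open>b\<close>.\<close>
  define b where "b = (1 + c) / (2 + c)"
  have b: "1/2 < b" "b < 1" and "(2 * b - 1) / (1 - b) = c"
    using assms by (auto simp: b_def field_simps)
  then have "c \<le> psi b" using psi_ge[of b] by simp
  moreover have "continuous_on {1/2..b} psi"
    unfolding psi_def Beta_def
    using b by (intro continuous_intros continuous_on_compose2[OF continuous_on_Gamma[of "{0<..}"]])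
       (auto simp: Gamma_eq_zero_iff elim!: nonpos_Ints_cases)
  ultimately obtain g where g: "1/2 \<le> g" "g \<le> b" "psi g = c"
    using IVT'[of psi "1/2" c b] assms b by (auto simp: psi_def)
  moreover have "g \<noteq> 1/2"
  proof
    assume "g = 1/2"
    then have "psi g = 0" by (simp add: psi_def)
    then show False using g assms by simp
  qed
  ultimately show ?thesis using that[of g] b by simp
qed

section \<open>The gamma quotient of the theorem\<close>

lemma not_Ints_between:
  assumes "of_int k < x" "x < of_int k + (1::real)"
  shows "x \<notin> \<int>"
proof
  assume "x \<in> \<int>"
  then obtain z where "x = of_int z" by (elim Ints_cases)
  with assms have "k < z" "z < k + 1" by linarith+
  then show False by simp
qed

text \<open>Legendre duplication at \<open>1/2 - g\<close> evaluates the product of the two gamma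
  values through \<open>Gamma (1 - 2 * g)\<close>; the functional equation moves that argument to
  \<open>2 - 2 * g\<close>, which produces the Beta function in \<open>psi\<close>.\<close>

lemma gamma_quotient_eq:
  assumes "1/2 < g" "g < (1::real)"
  shows "1 / (4 powr g * sqrt pi) * (Gamma (1/2 - g) / Gamma (1 - g)) = - 1 / psi g"
proof -
  have notint: "1/2 - g \<notin> \<int>" "1 - 2 * g \<notin> \<int>" "1 - g \<notin> \<int>"
    using assms not_Ints_between[of "- 1" "1/2 - g"] not_Ints_between[of "- 1" "1 - 2 * g"]
      not_Ints_between[of 0 "1 - g"] by auto
  have "complex_of_real (1/2 - g) \<notin> \<int>" "complex_of_real (1 - g) \<notin> \<int>"
    using notint unfolding of_real_in_Ints_iff by auto
  then have "complex_of_real (1/2 - g) \<notin> \<int>\<^sub>\<le>\<^sub>0" "complex_of_real (1/2 - g) + 1/2 \<notin> \<int>\<^sub>\<le>\<^sub>0"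
    using nonpos_Ints_subset_Ints by auto
  then have "Gamma (complex_of_real (1/2 - g)) * Gamma (complex_of_real (1/2 - g) + 1/2) =
      exp ((1 - 2 * complex_of_real (1/2 - g)) * of_real (ln 2)) * of_real (sqrt pi) * Gamma (2 * complex_of_real (1/2 - g))"
    by (rule Gamma_legendre_duplication)
  also have "complex_of_real (1/2 - g) + 1/2 = of_real (1 - g)" by simp
  also have "2 * complex_of_real (1/2 - g) = of_real (1 - 2 * g)" by simp
  also have "1 - complex_of_real (1 - 2 * g) = of_real (2 * g)" by simp
  finally have "complex_of_real (Gamma (1/2 - g) * Gamma (1 - g)) =
      complex_of_real (exp (2 * g * ln 2) * sqrt pi * Gamma (1 - 2 * g))"
    unfolding Gamma_complex_of_real exp_of_real of_real_mult[symmetric] .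
  then have dup: "Gamma (1/2 - g) * Gamma (1 - g) = exp (2 * g * ln 2) * sqrt pi * Gamma (1 - 2 * g)"
    unfolding of_real_eq_iff .
  have four: "exp (2 * g * ln 2) = 4 powr g"
    using ln_realpow[of 2 2] by (simp add: powr_def mult_ac)
  have G1: "Gamma (1 - g) > 0" "Gamma (2 - 2 * g) > 0"
    using assms by (auto intro: Gamma_real_pos)
  have "Gamma (1 - 2 * g + 1) = (1 - 2 * g) * Gamma (1 - 2 * g)"
    using notint nonpos_Ints_subset_Ints by (intro Gamma_plus1) auto
  then have G2: "Gamma (1 - 2 * g) = Gamma (2 - 2 * g) / (1 - 2 * g)"
    using assms by (simp add: field_simps)
  have "Gamma (1/2 - g) = 4 powr g * sqrt pi * Gamma (2 - 2 * g) / (1 - 2 * g) / Gamma (1 - g)"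
    using dup G1 unfolding four G2 by (subst nonzero_eq_divide_eq) auto
  then have "1 / (4 powr g * sqrt pi) * (Gamma (1/2 - g) / Gamma (1 - g)) =
     Gamma (2 - 2 * g) / ((1 - 2 * g) * (Gamma (1 - g) * Gamma (1 - g)))"
    by simp
  also have "\<dots> = - 1 / psi g"
  proof -
    have "psi g = - ((1 - 2 * g) * (Gamma (1 - g) * Gamma (1 - g)) / Gamma (2 - 2 * g))"
      by (simp add: psi_def Beta_def algebra_simps diff_divide_distrib)
    then show ?thesis by simp
  qed
  finally show ?thesis .
qed

text \<open>Minus the derivative of \<open>s powr (- g)\<close>, times
  \<open>(1 - s) powr (- g) - 1\<close>: the continuous analogue of \<open>scaled_term\<close>. The
  value at \<open>s = 1\<close> is set to 0 because \<open>0 powr (- g)\<close> is 0 and the formula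
  would be negative there.\<close>

definition kern :: "real \<Rightarrow> real \<Rightarrow> real" where
  "kern g s = (if s \<in> {0<..<1} then g * s powr (- g - 1) * ((1 - s) powr (- g) - 1) else 0)"

lemma one_le_powr_neg: "0 < x \<Longrightarrow> x \<le> 1 \<Longrightarrow> 0 \<le> g \<Longrightarrow> 1 \<le> x powr (- g)" for x g :: real
  using powr_mono2'[of "- g" x 1] by simp

lemma kern_nonneg: "g \<ge> 0 \<Longrightarrow> kern g s \<ge> 0"
  by (auto simp: kern_def intro!: mult_nonneg_nonneg one_le_powr_neg)

text \<open>Subtracting \<open>2 * g - 1\<close> times the Beta integrand from the kernel leaves an
  exact derivative \<open>K'\<close>, whose primitive \<open>K\<close> goes from 0 to 1.\<close>

lemma kern_has_integral:
  assumes "1/2 < g" "g < 1"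
  shows "(kern g has_integral (1 + psi g)) {0..1}"
proof -
  define K where "K = (\<lambda>s::real. s powr (- g) * (1 - (1 - s) powr (1 - g)))"
  define K' where "K' = (\<lambda>s::real. - g * s powr (- g - 1) * (1 - (1 - s) powr (1 - g)) +
      s powr (- g) * ((1 - g) * (1 - s) powr (- g)))"
  have "(K has_real_derivative K' s) (at s)" if "s \<in> {0<..<1}" for s
    using that unfolding K_def K'_def
    by (auto intro!: derivative_eq_intros simp: field_simps)
  have cont: "continuous_on {0..1} K"
  proof -
    have "continuous (at s within {0..1}) K" if s: "s \<in> {0..1}" for s
    proof (cases "s = 0")
      case False
      then show ?thesis using s assms unfolding K_def continuous_within
        by (intro tendsto_mult tendsto_diff tendsto_powr' tendsto_const tendsto_ident_at)
           (auto simp: eventually_at_filter)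
    next
      case True
      \<comment> \<open>Near 0 the factor \<open>s powr (- g)\<close> is unbounded, but the other
        factor lies between 0 and \<open>s\<close>.\<close>
      have "(K \<longlongrightarrow> 0) (at 0 within {0..1})"
      proof (rule tendsto_sandwich[of "\<lambda>_. 0" _ _ "\<lambda>s. s powr (1 - g)"])
        have bd: "0 \<le> K s \<and> K s \<le> s powr (1 - g)" if "s \<in> {0..1}" for s
        proof -
          have "1 - s \<le> (1 - s) powr (1 - g)"
            using that assms powr_mono'[of "1 - g" 1 "1 - s"] by simp
          moreover have "(1 - s) powr (1 - g) \<le> 1"
            using that assms by (intro powr_le1) auto
          ultimately have "0 \<le> s powr (- g) * (1 - (1 - s) powr (1 - g))"
            "s powr (- g) * (1 - (1 - s) powr (1 - g)) \<le> s powr (- g) * s"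
            by (auto intro!: mult_nonneg_nonneg mult_left_mono)
          moreover have "s powr (- g) * s = s powr (1 - g)"
            using that powr_mult_base[of s "- g"] by (simp add: mult.commute)
          ultimately show ?thesis by (simp add: K_def)
        qed
        show "\<forall>\<^sub>F s in at 0 within {0..1}. 0 \<le> K s" "\<forall>\<^sub>F s in at 0 within {0..1}. K s \<le> s powr (1 - g)"
          using bd by (auto simp: eventually_at_filter)
        show "((\<lambda>s. s powr (1 - g)) \<longlongrightarrow> 0) (at 0 within {0..1})"
        proof -
          have "((\<lambda>s::real. s powr (1 - g)) \<longlongrightarrow> 0 powr (1 - g)) (at 0 within {0..1})"
            using assms by (intro tendsto_powr' tendsto_const tendsto_ident_at)
              (auto simp: eventually_at_filter)
          then show ?thesis by simp
        qed
      qed auto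
      then show ?thesis using True by (simp add: continuous_within K_def)
    qed
    then show ?thesis by (simp add: continuous_on_eq_continuous_within)
  qed
  have "(K' has_integral (K 1 - K 0)) {0..1}"
    using cont \<open>\<And>s. s \<in> {0<..<1} \<Longrightarrow> (K has_real_derivative K' s) (at s)\<close>
    by (intro fundamental_theorem_of_calculus_interior)
       (auto simp: has_real_derivative_iff_has_vector_derivative)
  moreover have "((\<lambda>s. s powr (1 - g - 1) * (1 - s) powr (1 - g - 1)) has_integral Beta (1 - g) (1 - g)) {0..1}"
    using assms by (intro has_integral_Beta_real) auto
  ultimately have "((\<lambda>s. K' s + (2 * g - 1) * (s powr (1 - g - 1) * (1 - s) powr (1 - g - 1))) has_integral
      (K 1 - K 0 + (2 * g - 1) * Beta (1 - g) (1 - g))) {0..1}"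
    by (intro has_integral_add has_integral_mult_right)
  moreover have "K 1 - K 0 = 1" by (simp add: K_def)
  ultimately have "((\<lambda>s. K' s + (2 * g - 1) * (s powr (1 - g - 1) * (1 - s) powr (1 - g - 1))) has_integral
      (1 + psi g)) {0..1}"
    by (simp add: psi_def)
  moreover have *: "kern g s = K' s + (2 * g - 1) * (s powr (1 - g - 1) * (1 - s) powr (1 - g - 1))"
    if "s \<in> {0..1} - {0, 1}" for s
  proof -
    have s: "0 < s" "s < 1" using that by auto
    define a where "a = s powr (- g - 1)"
    define b where "b = (1 - s) powr (- g)"
    have 1: "s powr (- g) = a * s"
      using s powr_add[of s "- g - 1" 1] by (simp add: a_def)
    have 2: "(1 - s) powr (1 - g) = b * (1 - s)"
      using s powr_add[of "1 - s" "- g" 1] by (simp add: b_def)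
    show ?thesis
      using s by (simp add: kern_def K'_def 1 2 flip: a_def b_def) (simp add: algebra_simps)
  qed
  ultimately show ?thesis
    by (intro has_integral_spike_finite[of "{0,1}" _ "kern g", OF _ *]) auto
qed

section \<open>Riemann sums of the kernel\<close>

lemma powr_deriv_integral:
  assumes "0 < a" "a \<le> (b::real)"
  shows "((\<lambda>s. g * s powr (- g - 1)) has_integral (a powr (- g) - b powr (- g))) {a..b}"
proof -
  have "((\<lambda>s. - (s powr (- g))) has_vector_derivative g * s powr (- g - 1)) (at s within {a..b})"
    if "s \<in> {a..b}" for s
    using that assms unfolding has_real_derivative_iff_has_vector_derivative[symmetric]
    by (auto intro!: derivative_eq_intros)
  from fundamental_theorem_of_calculus[OF assms(2) this] show ?thesis by simp
qed

lemma kern_integrable: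
  assumes "1/2 < g" "g < 1" "0 \<le> a" "b \<le> 1"
  shows "kern g integrable_on {a..b}"
  using kern_has_integral[OF assms(1,2)] assms(3,4)
  by (auto intro: integrable_on_subinterval[of _ "{0..1}"])

text \<open>A summand of the convolution sum for the sequence \<open>i \<mapsto> i powr (- g)\<close> after division by
  \<open>m powr (- 2 * g)\<close>.\<close>
definition scaled_term :: "real \<Rightarrow> nat \<Rightarrow> nat \<Rightarrow> real" where
  "scaled_term g m i =
    ((real i / real m) powr (- g) - (real (Suc i) / real m) powr (- g)) * ((1 - real i / real m) powr (- g) - 1)"

text \<open>Each summand is at most the integral of the kernel from \<open>i / m\<close> to
  \<open>(i + 1) / m\<close>: the first factor integrates exactly, and the second is taken at the
  left endpoint, where it is smallest. No error term remains, so \<open>lis_tail_le\<close> holds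
  with constant 1.\<close>

lemma scaled_sum_le:
  assumes g: "1/2 < g" "g < 1" and m: "m \<ge> 1"
  shows "(\<Sum>i=1..<m. scaled_term g m i) \<le> 1 + psi g"
proof -
  have step: "scaled_term g m i \<le> integral {real i / m..real (Suc i) / m} (kern g)"
    if i: "1 \<le> i" "i < m" for i
  proof -
    let ?a = "real i / m" and ?b = "real (Suc i) / m"
    let ?c = "(1 - ?a) powr (- g) - 1"
    have ab: "0 < ?a" "?a < ?b" "?b \<le> 1" "?a < 1"
      using i m by (auto simp: field_simps)
    have "((\<lambda>s. g * s powr (- g - 1) * ?c) has_integral scaled_term g m i) {?a..?b}"
      unfolding scaled_term_def using ab by (intro has_integral_mult_left powr_deriv_integral) auto
    \<comment> \<open>The integrand is set to 0 at the point 1, where the kernel vanishes too; this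
      concerns only the last interval.\<close>
    then have "((\<lambda>s. if s = 1 then 0 else g * s powr (- g - 1) * ?c) has_integral scaled_term g m i) {?a..?b}"
      by (rule has_integral_spike_finite[of "{1}", rotated 2]) auto
    moreover have "(kern g has_integral integral {?a..?b} (kern g)) {?a..?b}"
      using ab g by (intro integrable_integral kern_integrable) auto
    ultimately show ?thesis
    proof (rule has_integral_le)
      fix s assume s: "s \<in> {?a..?b}"
      show "(if s = 1 then 0 else g * s powr (- g - 1) * ?c) \<le> kern g s"
      proof (cases "s = 1")
        case False
        then have s': "0 < s" "s < 1" using s ab by auto
        then have "(1 - ?a) powr (- g) \<le> (1 - s) powr (- g)"
          using s g by (intro powr_mono2') auto
        then show ?thesis using s' False g by (auto simp: kern_def intro!: mult_left_mono)
      qed (simp add: kern_def)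
    qed
  qed
  have "(\<Sum>i=1..<k. scaled_term g m i) \<le> integral {1 / m..real k / m} (kern g)" if "1 \<le> k" "k \<le> m" for k
    using that
  proof (induction k rule: dec_induct)
    case (step k)
    have "integral {1/m..real k / m} (kern g) + integral {real k / m..real (Suc k) / m} (kern g) =
          integral {1/m..real (Suc k) / m} (kern g)"
      using step.hyps step.prems g by (intro Henstock_Kurzweil_Integration.integral_combine kern_integrable) (auto simp: field_simps)
    moreover have "scaled_term g m k \<le> integral {real k / m..real (Suc k) / m} (kern g)"
      using step.hyps step.prems by (intro \<open>\<And>i. 1 \<le> i \<Longrightarrow> i < m \<Longrightarrow> _\<close>) auto
    ultimately show ?case using step by simp
  qed simp
  from this[of m] have "(\<Sum>i=1..<m. scaled_term g m i) \<le> integral {1/m..1} (kern g)"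
    using m by simp
  also have "\<dots> \<le> integral {0..1} (kern g)"
    using g m kern_nonneg by (intro integral_subset_le kern_integrable) auto
  also have "\<dots> = 1 + psi g"
    using kern_has_integral[OF g] by (rule integral_unique)
  finally show ?thesis .
qed

text \<open>The range leaves out 1 and \<open>m - 1\<close> because the subsolution in
  \<open>lis_tail_ge\<close> is a multiple of a power only from index 2 on, and both
  \<open>i\<close> and \<open>m - i\<close> occur there. By dominated convergence the loss
  disappears in the limit.\<close>

lemma scaled_sum_ge_eventually:
  assumes g: "1/2 < g" "g < 1" and c: "c < 1 + psi g"
  shows "\<forall>\<^sub>F m in sequentially. c < (\<Sum>i=2..<m-1. scaled_term g m i)"
proof -
  \<comment> \<open>Here \<open>m = Suc n\<close>. The shift by \<open>1 / m\<close> keeps the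
    second factor, on each interval of length \<open>1 / m\<close>, at most equal to its value at
    the left endpoint, so that integrals of \<open>f n\<close> bound the summands from
    below.\<close>
  define f where "f = (\<lambda>(n::nat) s. g * s powr (- g - 1) * ((1 + 1 / real (Suc n) - s) powr (- g) - 1))"
  define I where "I = (\<lambda>n::nat. {2 / real (Suc n)..1 - 1 / real (Suc n)})"
  define h where "h = (\<lambda>n s. if s \<in> I n then f n s else 0)"
  have I_sub: "I n \<subseteq> {0<..<1}" for n
  proof
    fix s assume "s \<in> I n"
    moreover have "0 < 2 / real (Suc n)" "1 - 1 / real (Suc n) < 1" by auto
    ultimately show "s \<in> {0<..<1}" unfolding I_def atLeastAtMost_iff greaterThanLessThan_iff by linarith
  qed
  have f_cont: "continuous_on {a..b} (f n)" if "0 < a" "b < 1 + 1 / real (Suc n)" for a b n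
    unfolding f_def using that by (intro continuous_intros) auto
  have f_int: "f n integrable_on {a..b}" if "0 < a" "b < 1 + 1 / real (Suc n)" for a b n
    using integrable_continuous_interval f_cont that by blast
  have h_int: "h n integrable_on {0..1}" for n
  proof -
    have "I n \<inter> {0..1} = I n" using I_sub[of n] by force
    moreover have "f n integrable_on I n"
      unfolding I_def by (intro f_int) (auto simp: field_simps)
    ultimately show ?thesis unfolding h_def by (simp add: integrable_restrict_Int)
  qed
  have h_le: "norm (h n s) \<le> kern g s" for n s
  proof (cases "s \<in> I n")
    case True
    then have s: "0 < s" "s < 1" "1 / real (Suc n) \<le> s"
      using I_sub[of n] by (auto simp: I_def intro: order_trans[rotated] divide_right_mono)
    have "1 \<le> (1 + 1 / real (Suc n) - s) powr (- g)"
      using s g by (intro one_le_powr_neg) (auto intro: less_le_trans[of _ 1])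
    moreover have "(1 + 1 / real (Suc n) - s) powr (- g) \<le> (1 - s) powr (- g)"
      using s g by (intro powr_mono2') auto
    ultimately show ?thesis
      using True s g by (auto simp: h_def f_def kern_def abs_mult intro!: mult_left_mono)
  qed (use g in \<open>auto simp: h_def kern_nonneg\<close>)
  have lim: "(\<lambda>n. h n s) \<longlonglongrightarrow> kern g s" if "s \<in> {0..1}" for s
  proof (cases "s \<in> {0<..<1}")
    case False
    then have "h n s = 0" for n using I_sub[of n] by (auto simp: h_def)
    then show ?thesis using False by (auto simp: kern_def)
  next
    case True
    have inv: "(\<lambda>n. 1 / real (Suc n)) \<longlonglongrightarrow> 0"
      using LIMSEQ_inverse_real_of_nat by (simp add: inverse_eq_divide)
    have "(\<lambda>n. f n s) \<longlonglongrightarrow> g * s powr (- g - 1) * ((1 + 0 - s) powr (- g) - 1)"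
      unfolding f_def using True by (intro tendsto_intros inv) auto
    moreover have "\<forall>\<^sub>F n in sequentially. h n s = f n s"
    proof -
      have "\<forall>\<^sub>F n in sequentially. 1 / real (Suc n) < min (s / 2) (1 - s)"
        using True by (intro order_tendstoD[OF inv]) auto
      then show ?thesis
        by eventually_elim (auto simp: h_def I_def)
    qed
    ultimately show ?thesis
      using True by (simp add: kern_def filterlim_cong)
  qed
  have "(\<lambda>n. integral {0..1} (h n)) \<longlonglongrightarrow> integral {0..1} (kern g)"
    using g by (intro dominated_convergence(2)[where h = "kern g"] h_int kern_integrable h_le lim) auto
  moreover have "integral {0..1} (kern g) = 1 + psi g"
    using kern_has_integral[OF g] by (rule integral_unique)
  ultimately have "\<forall>\<^sub>F n in sequentially. c < integral {0..1} (h n)"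
    using c by (intro order_tendstoD(1)) auto
  moreover have "\<forall>\<^sub>F n in sequentially. n \<ge> 3" by (rule eventually_ge_at_top)
  ultimately have "\<forall>\<^sub>F n in sequentially. c < (\<Sum>i=2..<Suc n - 1. scaled_term g (Suc n) i)"
  proof eventually_elim
    case (elim n)
    define m where "m = Suc n"
    have step: "integral {real i / m..real (Suc i) / m} (f n) \<le> scaled_term g m i"
      if i: "1 \<le> i" "i + 1 < m" for i
    proof -
      let ?a = "real i / m" and ?b = "real (Suc i) / m"
      let ?c = "(1 - ?a) powr (- g) - 1"
      have ab: "0 < ?a" "?a < ?b" "?b < 1" "?a < 1"
        using i by (auto simp: field_simps)
      have "(f n has_integral integral {?a..?b} (f n)) {?a..?b}"
        using ab by (intro integrable_integral f_int) (auto intro: less_trans[where y = 1])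
      moreover have "((\<lambda>s. g * s powr (- g - 1) * ?c) has_integral scaled_term g m i) {?a..?b}"
        unfolding scaled_term_def using ab by (intro has_integral_mult_left powr_deriv_integral) auto
      ultimately show ?thesis
      proof (rule has_integral_le)
        fix s assume s: "s \<in> {?a..?b}"
        have "?b = ?a + 1 / real (Suc n)" by (simp add: m_def add_divide_distrib)
        then have "(1 + 1 / real (Suc n) - s) powr (- g) \<le> (1 - ?a) powr (- g)"
          using s g ab by (intro powr_mono2') auto
        then show "f n s \<le> g * s powr (- g - 1) * ?c"
          unfolding f_def using g by (intro mult_left_mono) auto
      qed
    qed
    have "integral {2 / m..real k / m} (f n) \<le> (\<Sum>i=2..<k. scaled_term g m i)" if "2 \<le> k" "k < m" for k
      using that
    proof (induction k rule: dec_induct)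
      case (step k)
      have "integral {2/m..real k / m} (f n) + integral {real k / m..real (Suc k) / m} (f n) =
            integral {2/m..real (Suc k) / m} (f n)"
      proof (intro Henstock_Kurzweil_Integration.integral_combine f_int)
        have "real (Suc k) / m < 1" using step.prems by (simp add: field_simps)
        then show "real (Suc k) / m < 1 + 1 / real (Suc n)" by (rule less_trans) simp
      qed (use step.hyps step.prems in \<open>auto simp: field_simps\<close>)
      moreover have "integral {real k / m..real (Suc k) / m} (f n) \<le> scaled_term g m k"
        using step.hyps step.prems by (intro \<open>\<And>i. 1 \<le> i \<Longrightarrow> i + 1 < m \<Longrightarrow> _\<close>) auto
      ultimately show ?case using step by simp
    qed simp
    from this[of n] have "integral {2 / m..real n / m} (f n) \<le> (\<Sum>i=2..<n. scaled_term g m i)"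
      using elim by (simp add: m_def)
    also have "{2 / m..real n / m} = I n"
      by (simp add: I_def m_def field_simps)
    finally have "integral (I n) (f n) \<le> (\<Sum>i=2..<n. scaled_term g m i)" .
    moreover have "integral {0..1} (h n) = integral (I n) (f n)"
    proof -
      have "I n \<inter> {0..1} = I n" using I_sub[of n] by force
      then show ?thesis unfolding h_def by (simp add: integral_restrict_Int)
    qed
    ultimately show ?case using elim by (simp add: m_def)
  qed
  then show ?thesis
    by (subst (asm) eventually_sequentially_Suc[of "\<lambda>m. c < (\<Sum>i=2..<m-1. scaled_term g m i)"])
qed

section \<open>Tail of the Galton--Watson tree\<close>

text \<open>If \<open>H\<close> is the tail of a positive integer variable \<open>X\<close> and
  \<open>Y\<close> is an independent copy, this is the probability that \<open>X < m\<close>,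
  \<open>Y < m\<close> and \<open>X + Y >= m\<close>.\<close>

definition conv_gap :: "(nat \<Rightarrow> real) \<Rightarrow> nat \<Rightarrow> real" where
  "conv_gap H m = (\<Sum>x=1..<m. (H x - H (Suc x)) * (H (m - x) - H m))"

text \<open>Commutativity of convolution: for distribution functions both sides describe the sum of
  two independent variables. It lets \<open>tail_comparison\<close> exchange the two factors one at
  a time.\<close>

lemma diff_convolution_commute:
  fixes D E :: "nat \<Rightarrow> real"
  assumes "D 0 = 0" "E 0 = 0"
  shows "(\<Sum>x<m. (D (Suc x) - D x) * E (m - x)) = (\<Sum>x<m. (E (Suc x) - E x) * D (m - x))"
proof -
  have "(\<Sum>x<m. D (Suc x) * E (m - x)) = (\<Sum>x<m. E (Suc x) * D (m - x))"
    by (rule sum.reindex_bij_witness[of _ "\<lambda>x. m - Suc x" "\<lambda>x. m - Suc x"])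
       (auto simp: Suc_diff_Suc)
  moreover have "(\<Sum>x\<le>m. D x * E (m - x)) = (\<Sum>x\<le>m. E x * D (m - x))"
    by (rule sum.reindex_bij_witness[of _ "\<lambda>x. m - x" "\<lambda>x. m - x"]) auto
  ultimately show ?thesis
    using assms by (simp add: left_diff_distrib sum_subtractf lessThan_Suc_atMost[symmetric])
qed

lemma conv_gap_eq:
  assumes "H 0 = 1" "H 1 = 1" "m \<ge> 1"
  shows "conv_gap H m = (1 - H m)\<^sup>2 - (\<Sum>x<m. (H x - H (Suc x)) * (1 - H (m - x)))"
proof -
  have "conv_gap H m = (\<Sum>x<m. (H x - H (Suc x)) * (H (m - x) - H m))"
    unfolding conv_gap_def using assms
    by (intro sum.mono_neutral_left) (auto simp: not_le)
  also have "\<dots> = (\<Sum>x<m. (H x - H (Suc x)) * (1 - H m)) - (\<Sum>x<m. (H x - H (Suc x)) * (1 - H (m - x)))"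
    unfolding sum_subtractf[symmetric] by (intro sum.cong) (auto simp: algebra_simps)
  also have "(\<Sum>x<m. (H x - H (Suc x)) * (1 - H m)) = (1 - H m)\<^sup>2"
    unfolding sum_distrib_right[symmetric] sum_lessThan_telescope' using assms
    by (simp add: power2_eq_square)
  finally show ?thesis .
qed

text \<open>\<open>H\<close> is a supersolution and \<open>K\<close> a subsolution. The convolution
  sums at \<open>m\<close> depend only on earlier values, so by induction they increase when
  \<open>H\<close> is replaced by \<open>K\<close>. It remains that
  \<open>h^2 - p * (1 - h)^2\<close> is strictly increasing in \<open>h\<close> between 0 and
  1.\<close>

lemma tail_comparison:
  fixes H K :: "nat \<Rightarrow> real"
  assumes p: "0 < p" "p < 1"
    and H: "antimono H" "H 0 = 1" "H 1 = 1" "\<And>m. H m \<ge> 0" "\<And>m. m \<ge> 2 \<Longrightarrow> p * conv_gap H m \<le> (H m)\<^sup>2"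
    and K: "antimono K" "K 0 = 1" "K 1 = 1" "\<And>m. K m \<ge> 0" "\<And>m. m \<ge> 2 \<Longrightarrow> (K m)\<^sup>2 \<le> p * conv_gap K m"
  shows "K m \<le> H m"
proof (induction m rule: less_induct)
  case (less m)
  show ?case
  proof (cases "m \<ge> 2")
    case False
    then have "m = 0 \<or> m = 1" by auto
    then show ?thesis using H K by auto
  next
    case m: True
    have Hd: "H x - H (Suc x) \<ge> 0" and Kd: "K x - K (Suc x) \<ge> 0" for x
      using H(1) K(1) by (auto simp: antimono_iff_le_Suc)
    have "(\<Sum>x<m. (H x - H (Suc x)) * (1 - H (m - x))) \<le> (\<Sum>x<m. (H x - H (Suc x)) * (1 - K (m - x)))"
    proof (rule sum_mono)
      fix x assume "x \<in> {..<m}"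
      show "(H x - H (Suc x)) * (1 - H (m - x)) \<le> (H x - H (Suc x)) * (1 - K (m - x))"
      \<comment> \<open>At \<open>x = 0\<close> the difference in front is 0, so the induction
        hypothesis is needed only below \<open>m\<close>.\<close>
      proof (cases "x = 0")
        case False
        then show ?thesis using less[of "m - x"] m Hd by (intro mult_left_mono) auto
      qed (use H in auto)
    qed
    also have "\<dots> = (\<Sum>x<m. (K x - K (Suc x)) * (1 - H (m - x)))"
      using diff_convolution_commute[of "\<lambda>x. 1 - H x" "\<lambda>x. 1 - K x" m] H K by simp
    also have "\<dots> \<le> (\<Sum>x<m. (K x - K (Suc x)) * (1 - K (m - x)))"
    proof (rule sum_mono)
      fix x assume "x \<in> {..<m}"
      show "(K x - K (Suc x)) * (1 - H (m - x)) \<le> (K x - K (Suc x)) * (1 - K (m - x))"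
      proof (cases "x = 0")
        case False
        then show ?thesis using less[of "m - x"] m Kd by (intro mult_left_mono) auto
      qed (use K in auto)
    qed
    finally have "p * ((1 - K m)\<^sup>2 - conv_gap K m) \<ge> p * ((1 - H m)\<^sup>2 - conv_gap H m)"
      using conv_gap_eq[of H m] conv_gap_eq[of K m] H K m p by (intro mult_left_mono) auto
    then have le: "(K m)\<^sup>2 - p * (1 - K m)\<^sup>2 \<le> (H m)\<^sup>2 - p * (1 - H m)\<^sup>2"
      using H(5)[OF m] K(5)[OF m] by (simp add: algebra_simps)
    show ?thesis
    proof (rule ccontr)
      assume "\<not> K m \<le> H m"
      then have lt: "H m < K m" by simp
      have "K m \<le> 1" using antimonoD[OF K(1), of 0 m] K by simp
      have "(K m - H m) * ((K m + H m) + p * (2 - H m - K m)) > 0"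
        using lt H(4)[of m] \<open>K m \<le> 1\<close> p by (intro mult_pos_pos add_pos_nonneg mult_nonneg_nonneg) auto
      also have "(K m - H m) * ((K m + H m) + p * (2 - H m - K m)) =
         ((K m)\<^sup>2 - p * (1 - K m)\<^sup>2) - ((H m)\<^sup>2 - p * (1 - H m)\<^sup>2)"
        by (simp add: power2_eq_square algebra_simps)
      finally show False using le by simp
    qed
  qed
qed

lemma conv_term_scaled:
  assumes "1 \<le> i" "i < m"
  shows "(real i powr (- g) - real (Suc i) powr (- g)) * (real (m - i) powr (- g) - real m powr (- g)) =
    (real m powr (- g))\<^sup>2 * scaled_term g m i"
proof -
  have m: "real m powr (- g) \<noteq> 0" using assms by simp
  have 1: "(real i / real m) powr (- g) = real i powr (- g) / real m powr (- g)"
    "(real (Suc i) / real m) powr (- g) = real (Suc i) powr (- g) / real m powr (- g)"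
    by (intro powr_divide; simp)+
  have "1 - real i / real m = real (m - i) / real m"
    using assms by (simp add: of_nat_diff diff_divide_distrib)
  then have 2: "(1 - real i / real m) powr (- g) = real (m - i) powr (- g) / real m powr (- g)"
    by (simp only:) (intro powr_divide; simp)
  have "(a - b) * (c - d) = d\<^sup>2 * ((a / d - b / d) * (c / d - 1))" if "d \<noteq> 0" for a b c d :: real
    using that by (simp add: field_simps power2_eq_square)
  from this[OF m] show ?thesis unfolding scaled_term_def 1 2 .
qed

section \<open>Power bounds for the tail of \<open>lis\<close>\<close>

context
  fixes p :: real
  assumes p: "0 < p" "p < 1"
begin

lemma lis_tail_props:
  defines "G \<equiv> \<lambda>m. 1 - lis_cdf p m"
  shows "antimono G" "G 0 = 1" "G 1 = 1" "\<And>m. G m \<ge> 0" "\<And>m. m \<ge> 2 \<Longrightarrow> p * conv_gap G m = (G m)\<^sup>2"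
proof -
  show "antimono G" using lis_cdf_mono[OF p] by (auto simp: G_def antimono_def)
  show G0: "G 0 = 1" and G1: "G 1 = 1" using p by (auto simp: G_def)
  show "G m \<ge> 0" for m using lis_cdf_le_1[OF p] by (simp add: G_def)
  show "p * conv_gap G m = (G m)\<^sup>2" if "m \<ge> 2" for m
    using lis_cdf_rec[OF p that] conv_gap_eq[of G m] G0 G1 that by (simp add: G_def)
qed

text \<open>The power with the critical exponent is a supersolution: \<open>scaled_sum_le\<close>
  bounds its gap by \<open>1 + psi g = 1 / p\<close> times its square.\<close>

lemma lis_tail_le:
  assumes g: "1/2 < g" "g < 1" "psi g = (1 - p) / p" and m: "m \<ge> 1"
  shows "1 - lis_cdf p m \<le> real m powr (- g)"
proof -
  \<comment> \<open>Only the value at 0 differs from the power, as \<open>0 powr (- g)\<close> is 0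
    and not 1.\<close>
  define H where "H = (\<lambda>m. if m \<le> 1 then 1 else real m powr (- g))"
  have Hge: "H m = real m powr (- g)" if "m \<ge> 1" for m
    using that by (auto simp: H_def dest: le_antisym)
  have "1 - lis_cdf p m \<le> H m"
  proof (rule tail_comparison[OF p])
    show "antimono H"
      unfolding antimono_iff_le_Suc
    proof
      fix n
      show "H (Suc n) \<le> H n"
      proof (cases "n = 0")
        case False
        then show ?thesis using g by (simp add: Hge) (intro powr_mono2', auto)
      qed (simp add: H_def)
    qed
    show "p * conv_gap H m \<le> (H m)\<^sup>2" if m: "m \<ge> 2" for m
    proof -
      have "conv_gap H m = (\<Sum>i=1..<m. (real m powr (- g))\<^sup>2 * scaled_term g m i)"
        unfolding conv_gap_def
      proof (rule sum.cong)
        fix i assume i: "i \<in> {1..<m}"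
        then have "H i = real i powr (- g)" "H (Suc i) = real (Suc i) powr (- g)"
          "H (m - i) = real (m - i) powr (- g)" "H m = real m powr (- g)"
          by (auto simp only: atLeastLessThan_iff intro!: Hge)
        then show "(H i - H (Suc i)) * (H (m - i) - H m) = (real m powr (- g))\<^sup>2 * scaled_term g m i"
          using conv_term_scaled[of i m g] i by simp
      qed simp
      also have "\<dots> \<le> (real m powr (- g))\<^sup>2 * (1 + psi g)"
        unfolding sum_distrib_left[symmetric] using m by (intro mult_left_mono scaled_sum_le g) auto
      also have "1 + psi g = 1 / p" using p g by (simp add: field_simps)
      also have "real m powr (- g) = H m" using m by (simp add: Hge)
      finally show ?thesis using p by (simp add: field_simps)
    qed
  qed (use lis_tail_props in \<open>auto simp: H_def\<close>)
  then show ?thesis using Hge[OF m] by simp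
qed

text \<open>For large \<open>m\<close> every small multiple \<open>c\<close> of the power is a
  subsolution, since the square and the part of the gap that is used both scale like
  \<open>c^2\<close>. For the finitely many other \<open>m\<close> the summand \<open>x = 1\<close>
  is of lower order in \<open>c\<close>, because \<open>K 1 = 1\<close> is not scaled, and a small
  \<open>c\<close> makes it dominate.\<close>

lemma lis_tail_ge:
  assumes g: "1/2 < g" "g < 1" "psi g > (1 - p) / p"
  obtains c where "c > 0" "\<And>m. m \<ge> 1 \<Longrightarrow> c * real m powr (- g) \<le> 1 - lis_cdf p m"
proof -
  define q where "q = (\<lambda>m. real m powr (- g))"
  define d where "d = (\<lambda>m. q (m - 1) - q m)"
  have q1: "q 1 = 1" by (simp add: q_def)
  have q_mono: "q b \<le> q a" if "1 \<le> a" "a \<le> b" for a b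
    unfolding q_def using that g by (intro powr_mono2') auto
  have q_le: "q m \<le> 1" if "m \<ge> 1" for m using q_mono[of 1 m] that q1 by simp
  have q_nonneg: "q m \<ge> 0" for m by (simp add: q_def)
  have d_pos: "d m > 0" if "m \<ge> 2" for m
    unfolding d_def q_def using that g by (auto intro!: powr_less_mono2_neg)
  have "1 / p < 1 + psi g" using p g by (simp add: field_simps)
  from scaled_sum_ge_eventually[OF g(1,2) this] obtain B where
    B: "\<And>m. m \<ge> B \<Longrightarrow> 1 / p < (\<Sum>i=2..<m-1. scaled_term g m i)"
    by (auto simp: eventually_sequentially)
  \<comment> \<open>Up to the factor \<open>p / 2\<close>, the upper bounds that \<open>c\<close>
    has to respect: the decrements \<open>d m\<close> below \<open>B\<close>, and 1, which yields
    \<open>c_p\<close> and keeps the set nonempty.\<close>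
  define S where "S = insert 1 (d ` {3..<B})"
  define c where "c = p / 2 * Min S"
  have S: "finite S" "S \<noteq> {}" by (auto simp: S_def)
  have "Min S > 0" using S d_pos by (subst Min_gr_iff) (auto simp: S_def)
  then have c: "c > 0" using p by (simp add: c_def)
  have c_d: "c \<le> p / 2 * d m" if "3 \<le> m" "m < B" for m
    unfolding c_def using p that S by (intro mult_left_mono Min_le) (auto simp: S_def)
  have c_p: "c \<le> p / 2"
  proof -
    have "Min S \<le> 1" using S by (intro Min_le) (auto simp: S_def)
    then have "p / 2 * Min S \<le> p / 2 * 1" using p by (intro mult_left_mono) auto
    then show ?thesis by (simp add: c_def)
  qed
  define K where "K = (\<lambda>m. if m \<le> 1 then 1 else c * q m)"
  have K2: "K m = c * q m" if "m \<ge> 2" for m using that by (simp add: K_def)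
  have K_half: "K m \<le> 1/2" if "m \<ge> 2" for m
  proof -
    have "c * q m \<le> 1/2 * 1" using c c_p p q_le[of m] q_nonneg that by (intro mult_mono) auto
    then show ?thesis using K2[OF that] by simp
  qed
  have K_anti: "antimono K"
    unfolding antimono_iff_le_Suc
  proof
    fix n :: nat
    consider "n = 0" | "n = 1" | "n \<ge> 2" by linarith
    then show "K (Suc n) \<le> K n"
    proof cases
      case 2
      then show ?thesis using K_half[of 2] by (simp add: K_def numeral_2_eq_2)
    next
      case 3
      then show ?thesis using q_mono[of n "Suc n"] c by (simp add: K2)
    qed (simp add: K_def)
  qed
  have term_nonneg: "0 \<le> (K x - K (Suc x)) * (K (m - x) - K m)" for x m
    using antimonoD[OF K_anti, of x "Suc x"] antimonoD[OF K_anti, of "m - x" m]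
    by (intro mult_nonneg_nonneg) auto
  have first: "(1 - K 2) * (K (m - 1) - K m) \<le> conv_gap K m" if "m \<ge> 2" for m
    unfolding conv_gap_def
  proof -
    have "(K 1 - K (Suc 1)) * (K (m - 1) - K m) \<le> (\<Sum>x=1..<m. (K x - K (Suc x)) * (K (m - x) - K m))"
      by (rule member_le_sum) (use that term_nonneg in auto)
    moreover have "K 1 = 1" "Suc 1 = 2" by (auto simp: K_def)
    ultimately show "(1 - K 2) * (K (m - 1) - K m) \<le> (\<Sum>x=1..<m. (K x - K (Suc x)) * (K (m - x) - K m))"
      by (simp only:)
  qed
  have gap: "(K m)\<^sup>2 \<le> p * conv_gap K m" if m: "m \<ge> 2" for m
  proof -
    consider "m = 2" | "3 \<le> m" "m < B" | "3 \<le> m" "B \<le> m" using m by linarith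
    then show ?thesis
    proof cases
      case 1
      have "1/2 * (1/2) \<le> (1 - K 2) * (1 - K 2)"
        using K_half[of 2] by (intro mult_mono) auto
      also have "\<dots> \<le> conv_gap K 2" using first[of 2] by (simp add: K_def)
      finally have "p * (1/4) \<le> p * conv_gap K 2" using p by simp
      moreover have "(K 2)\<^sup>2 \<le> p * (1/4)"
      proof -
        have "K 2 \<le> c" using K2[of 2] q_le[of 2] c by simp
        then have "K 2 \<le> p / 2" using c_p by simp
        then have "K 2 * K 2 \<le> (p / 2) * (1/2)"
          using K_half[of 2] p c q_nonneg[of 2] K2[of 2] by (intro mult_mono) auto
        then show ?thesis by (simp add: power2_eq_square)
      qed
      ultimately show ?thesis using 1 by simp
    next
      case 2
      have "K (m - 1) - K m = c * d m"
        using 2 K2[of m] K2[of "m - 1"] by (simp add: d_def algebra_simps)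
      then have "(1 - K 2) * (c * d m) \<le> conv_gap K m"
        using first[OF m] by simp
      moreover have "1/2 * (c * d m) \<le> (1 - K 2) * (c * d m)"
        using K_half[of 2] c d_pos[OF m] by (intro mult_right_mono) auto
      ultimately have "1/2 * (c * d m) \<le> conv_gap K m" by (rule order_trans[rotated])
      then have A: "p * (1/2 * (c * d m)) \<le> p * conv_gap K m"
        using p by (intro mult_left_mono) auto
      have "K m * K m \<le> c * (p / 2 * d m)"
      proof (intro mult_mono)
        show "K m \<le> c" using K2[OF m] q_le[of m] m c by simp
        with c_d[OF 2] show "K m \<le> p / 2 * d m" by simp
      qed (use c K2[OF m] q_nonneg[of m] in auto)
      then show ?thesis using A by (simp add: power2_eq_square mult_ac)
    next
      case 3
      have "(c * q m)\<^sup>2 * (1 / p) \<le> (c * q m)\<^sup>2 * (\<Sum>i=2..<m-1. scaled_term g m i)"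
        using B[OF 3(2)] by (intro mult_left_mono) auto
      also have "\<dots> = (\<Sum>i=2..<m-1. (K i - K (Suc i)) * (K (m - i) - K m))"
        unfolding sum_distrib_left
      proof (rule sum.cong)
        fix i assume i: "i \<in> {2..<m-1}"
        then have "K i = c * q i" "K (Suc i) = c * q (Suc i)" "K (m - i) = c * q (m - i)" "K m = c * q m"
          by (intro K2; simp; linarith)+
        then have "(K i - K (Suc i)) * (K (m - i) - K m) =
           c\<^sup>2 * ((q i - q (Suc i)) * (q (m - i) - q m))"
          by (simp add: power2_eq_square algebra_simps)
        also have "(q i - q (Suc i)) * (q (m - i) - q m) = (q m)\<^sup>2 * scaled_term g m i"
          unfolding q_def using i by (intro conv_term_scaled) auto
        finally show "(c * q m)\<^sup>2 * scaled_term g m i = (K i - K (Suc i)) * (K (m - i) - K m)"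
          by (simp add: power_mult_distrib)
      qed simp
      also have "\<dots> \<le> conv_gap K m"
        unfolding conv_gap_def using term_nonneg by (intro sum_mono2) auto
      finally show ?thesis using p K2[OF m] by (simp add: field_simps)
    qed
  qed
  have "K m \<le> 1 - lis_cdf p m" for m
    by (rule tail_comparison[OF p, of "\<lambda>m. 1 - lis_cdf p m" K])
       (use lis_tail_props K_anti gap c q_nonneg in \<open>auto simp: K_def\<close>)
  moreover have "c * q m \<le> K m" if "m \<ge> 1" for m
  proof (cases "m = 1")
    case True
    then show ?thesis using c_p p by (simp add: K_def q_def)
  qed (use that in \<open>auto simp: K_def\<close>)
  ultimately have "c * q m \<le> 1 - lis_cdf p m" if "m \<ge> 1" for m
    using that order_trans by blast
  then show ?thesis using that[OF c] by (simp add: q_def)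
qed

end

section \<open>Uniform trees\<close>

text \<open>All-plus trees stand for unsigned shapes, as in \<open>random_tree\<close>.\<close>

fun shape :: "stree \<Rightarrow> stree" where
  "shape Leaf = Leaf"
| "shape (Node s l r) = Node True (shape l) (shape r)"

lemma allpos_shape: "allpos (shape t)"
  by (induction t) auto

lemma nleaves_shape [simp]: "nleaves (shape t) = nleaves t"
  by (induction t) auto

lemma shape_allpos: "allpos t \<Longrightarrow> shape t = t"
  by (induction t) auto

text \<open>The Galton--Watson weight of a tree with \<open>n\<close> leaves is \<open>2 ^ (1 - 2 n)\<close> times the
  probability of its signs.\<close>
lemma pmf_resign:
  assumes "0 < p" "p < 1"
  shows "pmf (resign p s) t = (if shape t = shape s then gw_weight p t * 4 ^ nleaves t / 2 else 0)"
proof (induction s arbitrary: t)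
  case Leaf
  show ?case by (cases t) auto
next
  case (Node b l r)
  define f where "f = (\<lambda>(s, l, r). Node s l r)"
  have eq: "resign p (Node b l r) =
      map_pmf f (pair_pmf (bernoulli_pmf p) (pair_pmf (resign p l) (resign p r)))"
    by (simp add: map_pmf_def pair_pmf_def bind_assoc_pmf bind_return_pmf f_def)
  have inj: "inj f" by (auto simp: inj_def f_def)
  show ?case
  proof (cases t)
    case Leaf
    have "Leaf \<notin> range f" by (auto simp: f_def)
    then have "Leaf \<notin> set_pmf (resign p (Node b l r))" unfolding eq by auto
    then show ?thesis using Leaf by (simp add: pmf_eq_0_set_pmf)
  next
    case (Node s' l' r')
    have "pmf (resign p (Node b l r)) (f (s', l', r')) =
       pmf (bernoulli_pmf p) s' * (pmf (resign p l) l' * pmf (resign p r) r')"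
      unfolding eq by (simp add: pmf_map_inj'[OF inj] pmf_pair)
    then show ?thesis
      using assms unfolding Node.IH Node by (cases s') (auto simp: f_def power_add)
  qed
qed

text \<open>The uniform signed tree is the Galton--Watson tree conditioned to have \<open>n\<close>
  leaves: the weight is the sign probability times a constant depending only on
  \<open>n\<close>.\<close>

lemma pmf_random_tree:
  assumes p: "0 < p" "p < 1" and n: "n \<ge> 1"
  shows "pmf (random_tree p n) t = (if t \<in> trees n then gw_weight p t / wsum p n (\<lambda>_. 1) else 0)"
proof -
  define S where "S = {t. nleaves t = n \<and> allpos t}"
  have S: "finite S" by (rule finite_subset[OF _ finite_trees[of n]]) (auto simp: S_def trees_def)
  have "wsum p n (\<lambda>_. 1) > 0"
    using n by (intro less_le_trans[OF _ wsum_one_ge]) auto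
  then obtain t0 where "t0 \<in> trees n" by (cases "trees n = {}") (auto simp: wsum_def)
  then have "shape t0 \<in> S" by (auto simp: S_def trees_def allpos_shape)
  then have S': "S \<noteq> {}" by auto
  \<comment> \<open>The number of shapes is never computed; total mass 1 determines \<open>k\<close>
    at the end.\<close>
  define k where "k = 4 ^ n / 2 / real (card S)"
  have pmf: "pmf (random_tree p n) t = (if t \<in> trees n then gw_weight p t * k else 0)" for t
  proof -
    have "pmf (random_tree p n) t = (\<Sum>s\<in>S. pmf (resign p s) t) / real (card S)"
      unfolding random_tree_def S_def[symmetric] using S S' by (simp add: pmf_bind_pmf_of_set)
    also have "(\<Sum>s\<in>S. pmf (resign p s) t) =
        (\<Sum>s\<in>S. if s = shape t then gw_weight p t * 4 ^ nleaves t / 2 else 0)"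
      by (intro sum.cong) (auto simp: pmf_resign[OF p] S_def shape_allpos)
    also have "\<dots> = (if t \<in> trees n then gw_weight p t * 4 ^ nleaves t / 2 else 0)"
      using S by (auto simp: S_def trees_def allpos_shape)
    finally show ?thesis by (auto simp: k_def trees_def)
  qed
  have "(\<Sum>t\<in>trees n. pmf (random_tree p n) t) = 1"
    by (rule sum_pmf_eq_1) (auto simp: set_pmf_iff pmf split: if_splits)
  then have "wsum p n (\<lambda>_. 1) * k = 1"
    by (simp add: pmf wsum_def sum_distrib_right)
  then have "k = 1 / wsum p n (\<lambda>_. 1)"
    using \<open>wsum p n (\<lambda>_. 1) > 0\<close> by (simp add: field_simps)
  then show ?thesis by (simp add: pmf)
qed

lemma prob_random_tree:
  assumes p: "0 < p" "p < 1" and n: "n \<ge> 1"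
  shows "measure_pmf.prob (random_tree p n) {t. P t} = wsum p n (\<lambda>t. of_bool (P t)) / wsum p n (\<lambda>_. 1)"
proof -
  have "measure_pmf.prob (random_tree p n) {t. P t} = measure_pmf.prob (random_tree p n) {t \<in> trees n. P t}"
    by (rule measure_prob_cong_0) (auto simp: pmf_random_tree[OF assms])
  also have "\<dots> = (\<Sum>t | t \<in> trees n \<and> P t. gw_weight p t / wsum p n (\<lambda>_. 1))"
    by (subst measure_measure_pmf_finite) (auto simp: pmf_random_tree[OF assms])
  also have "\<dots> = wsum p n (\<lambda>t. of_bool (P t)) / wsum p n (\<lambda>_. 1)"
    unfolding wsum_def sum_divide_distrib
    by (intro sum.mono_neutral_cong_left) auto
  finally show ?thesis .
qed

section \<open>Deviation bounds and the limit for trees with \<open>n\<close> leaves\<close>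

context
  fixes p g :: real
  assumes p: "0 < p" "p < 1" and g: "1/2 < g" "g < 1" "psi g = (1 - p) / p"
begin

text \<open>The tail bound at \<open>m\<close> near \<open>n powr b\<close> is divided by the
  probability of at least \<open>n\<close> leaves, which is of order
  \<open>1 / sqrt n\<close>.\<close>

lemma lis_upper_deviation:
  assumes b: "b * g > 1/2"
  shows "(\<lambda>n. measure_pmf.prob (random_tree p n) {t. real (lis t) > real n powr b}) \<longlonglongrightarrow> 0"
proof (rule tendsto_sandwich[of "\<lambda>_. 0"])
  show "\<forall>\<^sub>F n in sequentially. measure_pmf.prob (random_tree p n) {t. real (lis t) > real n powr b}
      \<le> 2 * real n powr (1/2 - b * g)"
    using eventually_ge_at_top[of 1]
  proof eventually_elim
    case (elim n)
    define m where "m = nat \<lceil>real n powr b\<rceil>"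
    have pow: "real n powr b > 0" using elim by simp
    have m: "real n powr b \<le> real m" "m \<ge> 1"
      using pow by (auto simp: m_def real_nat_ceiling_ge Suc_le_eq)
    have "measure_pmf.prob (random_tree p n) {t. real (lis t) > real n powr b}
        \<le> measure_pmf.prob (random_tree p n) {t. lis t \<ge> m}"
      by (intro measure_pmf.finite_measure_mono) (auto simp: m_def ceiling_le_iff)
    also have "\<dots> = wsum p n (\<lambda>t. of_bool (m \<le> lis t)) / wsum p n (\<lambda>_. 1)"
      by (rule prob_random_tree[OF p elim])
    also have "\<dots> \<le> real m powr (- g) / gw_tail (n - 1)"
      using high_weight_le[OF p elim, of m] lis_tail_le[OF p g m(2)] gw_tail_pos[of "n - 1"]
      by (simp add: pos_le_divide_eq)
    also have "\<dots> \<le> (real n powr b) powr (- g) / (1 / (2 * sqrt (real n)))"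
      using gw_tail_ge[of "n - 1"] elim m pow g gw_tail_pos[of "n - 1"]
      by (intro frac_le powr_mono2') auto
    also have "\<dots> = 2 * real n powr (1/2 - b * g)"
      using elim powr_add[of "real n" "1/2" "- (b * g)"]
      by (simp add: powr_powr powr_half_sqrt[symmetric])
    finally show ?case .
  qed
  have "1/2 - b * g < 0" using b by simp
  then show "(\<lambda>n. 2 * real n powr (1/2 - b * g)) \<longlonglongrightarrow> 0"
    by real_asymp
qed auto

text \<open>At \<open>m\<close> near \<open>n powr b\<close> the squared tail is at least of order
  \<open>n powr (- 2 * b * \<theta>)\<close> for an exponent \<theta> above \<open>g\<close>. With
  \<theta> close to \<open>g\<close>, \<open>n\<close> times this grows like a positive power of
  \<open>n\<close>, and \<open>low_weight_exp_bound\<close> gives a stretched exponential.\<close>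

lemma lis_lower_deviation:
  assumes b: "b * g < 1/2"
  shows "(\<lambda>n. measure_pmf.prob (random_tree p n) {t. real (lis t) < real n powr b}) \<longlonglongrightarrow> 0"
proof (cases "b \<le> 0")
  case True
  \<comment> \<open>The threshold is at most 1 here, and \<open>lis\<close> is never below
    1.\<close>
  have "\<forall>\<^sub>F n in sequentially. measure_pmf.prob (random_tree p n) {t. real (lis t) < real n powr b} = 0"
    using eventually_ge_at_top[of 1]
  proof eventually_elim
    case (elim n)
    have "real n powr b \<le> 1" using elim True powr_mono[of b 0 "real n"] by simp
    moreover have "real (lis t) \<ge> 1" for t using lis_pos[of t] by linarith
    ultimately have "{t. real (lis t) < real n powr b} = {}"
      by (auto simp: not_less intro: order_trans)
    then show ?case by simp
  qed
  then show ?thesis by (simp add: tendsto_eventually)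
next
  case False
  then have b0: "b > 0" by simp
  \<comment> \<open>\<open>lis_tail_ge\<close> requires an exponent strictly above \<open>g\<close>;
    the slack in \<open>b * g < 1/2\<close> leaves room for one.\<close>
  have "g < min 1 (1 / (2 * b))" using g b b0 by (simp add: field_simps)
  then obtain \<theta> where "g < \<theta>" "\<theta> < min 1 (1 / (2 * b))" using dense by blast
  then have \<theta>: "g < \<theta>" "\<theta> < 1" "2 * b * \<theta> < 1" using b0 by (auto simp: field_simps)
  have "psi \<theta> > (1 - p) / p" using psi_strict_mono[of g \<theta>] g \<theta> by simp
  then obtain c where c: "c > 0" "\<And>m. m \<ge> 1 \<Longrightarrow> c * real m powr (- \<theta>) \<le> 1 - lis_cdf p m"
    using lis_tail_ge[OF p, of \<theta>] g \<theta> by auto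
  \<comment> \<open>The factor \<open>2 powr (- \<theta>)\<close> comes from rounding,
    \<open>m\<close> being at most \<open>2 * n powr b\<close>. The constant \<open>k'\<close> comes
    from \<open>ln (1 + y) >= y / (1 + y) >= y / (1 + k)\<close> for \<open>y\<close> between 0 and
    \<open>k\<close>.\<close>
  define k where "k = (c * 2 powr (- \<theta>))\<^sup>2 / 2"
  define k' where "k' = k / (1 + k)"
  define \<delta> where "\<delta> = 1 - 2 * b * \<theta>"
  have "k > 0" using c by (simp add: k_def)
  then have k: "k > 0" "k' > 0" by (auto simp: k'_def)
  have \<delta>: "\<delta> > 0" using \<theta> by (simp add: \<delta>_def)
  show ?thesis
  proof (rule tendsto_sandwich[of "\<lambda>_. 0"])
    show "\<forall>\<^sub>F n in sequentially. measure_pmf.prob (random_tree p n) {t. real (lis t) < real n powr b}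
        \<le> 4 * (real n)\<^sup>2 * exp (- k' * real n powr \<delta>)"
      using eventually_ge_at_top[of 2]
    proof eventually_elim
      case (elim n)
      then have n: "n \<ge> 1" by simp
      define m where "m = nat \<lceil>real n powr b\<rceil>"
      have pow: "real n powr b > 1" using elim b0 by simp
      have m: "m \<ge> 2" "real n powr b \<le> real m" "real m \<le> 2 * real n powr b"
        using pow unfolding m_def by linarith+
      define G where "G = 1 - lis_cdf p m"
      define y where "y = k * real n powr (- (2 * b * \<theta>))"
      have "real n powr (- (2 * b * \<theta>)) \<le> 1"
        using powr_mono[of "- (2 * b * \<theta>)" 0 "real n"] b0 \<theta> g n by simp
      then have y: "0 < y" "y \<le> k"
        using k n by (auto simp: y_def)
      have "c * (2 * real n powr b) powr (- \<theta>) \<le> c * real m powr (- \<theta>)"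
        using c m \<theta> g by (intro mult_left_mono powr_mono2') auto
      also have "\<dots> \<le> G" using c(2)[of m] m by (simp add: G_def)
      finally have "(c * (2 * real n powr b) powr (- \<theta>))\<^sup>2 / 2 \<le> G\<^sup>2 / 2"
        using c by (intro divide_right_mono power_mono) auto
      also have "(c * (2 * real n powr b) powr (- \<theta>))\<^sup>2 / 2 = y"
        by (simp add: y_def k_def power_mult_distrib powr_mult powr_powr power2_eq_square
            powr_add[symmetric] mult_ac)
      finally have Gy: "y \<le> G\<^sup>2 / 2" .
      have "G \<ge> 0" using lis_cdf_le_1[OF p] by (simp add: G_def)
      have "G \<noteq> 0" using Gy y by auto
      then have G: "lis_cdf p m < 1" using \<open>G \<ge> 0\<close> by (simp add: G_def)
      have "exp (k' * real n powr \<delta>) = exp (real n * (y / (1 + k)))"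
        using n by (simp add: k'_def y_def \<delta>_def powr_diff powr_minus field_simps)
      also have "\<dots> \<le> exp (real n * ln (1 + y))"
      proof -
        have "y / (1 + k) \<le> y / (1 + y)" using y by (intro divide_left_mono) auto
        also have "\<dots> \<le> ln (1 + y)"
          using ln_le_minus_one[of "1 / (1 + y)"] y by (simp add: ln_div field_simps)
        finally have "real n * (y / (1 + k)) \<le> real n * ln (1 + y)"
          by (rule mult_left_mono) simp
        then show ?thesis by (simp only: exp_le_cancel_iff)
      qed
      also have "\<dots> = (1 + y) ^ n"
        using y by (simp add: exp_of_nat_mult)
      also have "\<dots> \<le> (1 + G\<^sup>2 / 2) ^ n"
        using Gy y by (intro power_mono) auto
      finally have ex: "exp (k' * real n powr \<delta>) \<le> (1 + G\<^sup>2 / 2) ^ n" .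
      have "low_weight p m n * exp (k' * real n powr \<delta>) \<le> low_weight p m n * (1 + G\<^sup>2 / 2) ^ n"
        using ex low_weight_nonneg[OF p] by (intro mult_left_mono) auto
      also have "\<dots> \<le> 1"
        unfolding G_def by (rule low_weight_exp_bound[OF p m(1) G])
      finally have low: "low_weight p m n \<le> exp (- k' * real n powr \<delta>)"
        by (simp add: exp_minus field_simps)
      have "measure_pmf.prob (random_tree p n) {t. real (lis t) < real n powr b}
          \<le> measure_pmf.prob (random_tree p n) {t. lis t < m}"
        using m by (intro measure_pmf.finite_measure_mono) auto
      also have "\<dots> = low_weight p m n / wsum p n (\<lambda>_. 1)"
        unfolding low_weight_def by (rule prob_random_tree[OF p n])
      also have "\<dots> \<le> exp (- k' * real n powr \<delta>) / (1 / (4 * (real n)\<^sup>2))"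
        using low n wsum_one_ge[OF n, of p] by (intro frac_le) auto
      finally show ?case by (simp add: mult_ac)
    qed
    show "(\<lambda>n. 4 * (real n)\<^sup>2 * exp (- k' * real n powr \<delta>)) \<longlonglongrightarrow> 0"
      using k(2) \<delta> by real_asymp
  qed auto
qed

text \<open>The two deviation bounds meet at \<open>b = 1 / (2 * g)\<close>, where
  \<open>b * g = 1/2\<close>.\<close>

lemma lis_exponent_limit:
  assumes \<epsilon>: "\<epsilon> > 0"
  shows "(\<lambda>n. measure_pmf.prob (random_tree p n)
          {t. \<bar>ln (real (lis t)) / ln (real n) - 1 / (2 * g)\<bar> > \<epsilon>}) \<longlonglongrightarrow> 0"
proof (rule tendsto_sandwich[of "\<lambda>_. 0"])
  let ?a = "1 / (2 * g)"
  show "\<forall>\<^sub>F n in sequentially. measure_pmf.prob (random_tree p n)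
          {t. \<bar>ln (real (lis t)) / ln (real n) - ?a\<bar> > \<epsilon>}
        \<le> measure_pmf.prob (random_tree p n) {t. real (lis t) > real n powr (?a + \<epsilon>)} +
          measure_pmf.prob (random_tree p n) {t. real (lis t) < real n powr (?a - \<epsilon>)}"
    using eventually_ge_at_top[of 2]
  proof eventually_elim
    case (elim n)
    have ln: "ln (real n) > 0" using elim by simp
    have "{t. \<bar>ln (real (lis t)) / ln (real n) - ?a\<bar> > \<epsilon>} \<subseteq>
       {t. real (lis t) > real n powr (?a + \<epsilon>)} \<union> {t. real (lis t) < real n powr (?a - \<epsilon>)}"
    proof
      fix t assume "t \<in> {t. \<bar>ln (real (lis t)) / ln (real n) - ?a\<bar> > \<epsilon>}"
      then have "ln (real (lis t)) / ln (real n) > ?a + \<epsilon> \<or> ln (real (lis t)) / ln (real n) < ?a - \<epsilon>"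
        by auto
      then have "ln (real (lis t)) > (?a + \<epsilon>) * ln (real n) \<or> ln (real (lis t)) < (?a - \<epsilon>) * ln (real n)"
        using ln by (simp only: pos_less_divide_eq pos_divide_less_eq)
      moreover have "real (lis t) > 0" using lis_pos[of t] by simp
      ultimately have "real (lis t) > exp ((?a + \<epsilon>) * ln (real n)) \<or> real (lis t) < exp ((?a - \<epsilon>) * ln (real n))"
        by (metis exp_less_cancel_iff exp_ln)
      then show "t \<in> {t. real (lis t) > real n powr (?a + \<epsilon>)} \<union> {t. real (lis t) < real n powr (?a - \<epsilon>)}"
        using elim by (auto simp: powr_def)
    qed
    then have "measure_pmf.prob (random_tree p n) {t. \<bar>ln (real (lis t)) / ln (real n) - ?a\<bar> > \<epsilon>} \<le>
       measure_pmf.prob (random_tree p n)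
         ({t. real (lis t) > real n powr (?a + \<epsilon>)} \<union> {t. real (lis t) < real n powr (?a - \<epsilon>)})"
      by (intro measure_pmf.finite_measure_mono) auto
    also have "\<dots> \<le> measure_pmf.prob (random_tree p n) {t. real (lis t) > real n powr (?a + \<epsilon>)} +
          measure_pmf.prob (random_tree p n) {t. real (lis t) < real n powr (?a - \<epsilon>)}"
      by (intro measure_Un_le) auto
    finally show ?case .
  qed
  have "(?a + \<epsilon>) * g > 1/2" "(?a - \<epsilon>) * g < 1/2"
    using \<epsilon> g by (auto simp: field_simps)
  from tendsto_add[OF lis_upper_deviation[OF this(1)] lis_lower_deviation[OF this(2)]]
  show "(\<lambda>n. measure_pmf.prob (random_tree p n) {t. real (lis t) > real n powr (?a + \<epsilon>)} +
          measure_pmf.prob (random_tree p n) {t. real (lis t) < real n powr (?a - \<epsilon>)}) \<longlonglongrightarrow> 0"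
    by simp
qed auto

end

theorem theorem2p2:
  fixes p :: real
  assumes "0 < p" "p < 1"
  shows "\<exists>\<alpha>::real. \<alpha> \<in> {1/2<..<1} \<and>
     1 / (4 powr (1 / (2*\<alpha>)) * sqrt pi) * (Gamma (1/2 - 1/(2*\<alpha>)) / Gamma (1 - 1/(2*\<alpha>)))
        = p / (p - 1) \<and>
     (\<forall>\<beta>\<in>{1/2<..<1}.
        1 / (4 powr (1 / (2*\<beta>)) * sqrt pi) * (Gamma (1/2 - 1/(2*\<beta>)) / Gamma (1 - 1/(2*\<beta>)))
          = p / (p - 1) \<longrightarrow> \<beta> = \<alpha>) \<and>
     (\<forall>\<epsilon>>0. (\<lambda>n. measure_pmf.prob (random_tree p n)
          {t. \<bar>ln (real (LIS t)) / ln (real n) - \<alpha>\<bar> > \<epsilon>}) \<longlonglongrightarrow> 0)"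
proof -
  have "(1 - p) / p > 0" using assms by simp
  then obtain g where g: "1/2 < g" "g < 1" "psi g = (1 - p) / p" by (rule psi_surj)
  \<comment> \<open>In the variable \<open>h = 1 / (2 * \<alpha>)\<close>, which maps the interval
    from 1/2 to 1 onto itself, the equation reads \<open>psi h = (1 - p) / p\<close>; strict
    monotonicity of \<open>psi\<close> gives uniqueness.\<close>
  have root_iff: "1 / (4 powr h * sqrt pi) * (Gamma (1/2 - h) / Gamma (1 - h)) = p / (p - 1) \<longleftrightarrow> h = g"
    if h: "1/2 < h" "h < 1" for h
  proof -
    have "psi h > 0" using h Beta_real_pos[of "1 - h" "1 - h"] by (simp add: psi_def)
    then have "- 1 / psi h = p / (p - 1) \<longleftrightarrow> psi h = psi g"
      using assms unfolding g(3) by (auto simp: field_simps)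
    also have "\<dots> \<longleftrightarrow> h = g"
      using psi_strict_mono[of h g] psi_strict_mono[of g h] h g by (cases h g rule: linorder_cases) auto
    finally show ?thesis unfolding gamma_quotient_eq[OF h] .
  qed
  show ?thesis
  proof (intro exI[of _ "1 / (2 * g)"] conjI ballI impI allI)
    show "1 / (2 * g) \<in> {1/2<..<1}" using g by (auto simp: field_simps)
    have "1 / (2 * (1 / (2 * g))) = g" using g by simp
    then show "1 / (4 powr (1 / (2*(1 / (2 * g)))) * sqrt pi) *
        (Gamma (1/2 - 1/(2*(1 / (2 * g)))) / Gamma (1 - 1/(2*(1 / (2 * g))))) = p / (p - 1)"
      using root_iff[OF g(1,2)] by simp
  next
    fix \<beta> :: real assume \<beta>: "\<beta> \<in> {1/2<..<1}"
      "1 / (4 powr (1 / (2*\<beta>)) * sqrt pi) * (Gamma (1/2 - 1/(2*\<beta>)) / Gamma (1 - 1/(2*\<beta>))) = p / (p - 1)"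
    have "1/2 < 1 / (2 * \<beta>)" "1 / (2 * \<beta>) < 1" using \<beta>(1) by (auto simp: field_simps)
    from root_iff[OF this] \<beta> have "1 / (2 * \<beta>) = g" by simp
    then show "\<beta> = 1 / (2 * g)" by auto
  next
    fix \<epsilon> :: real assume "\<epsilon> > 0"
    then show "(\<lambda>n. measure_pmf.prob (random_tree p n)
          {t. \<bar>ln (real (LIS t)) / ln (real n) - 1 / (2 * g)\<bar> > \<epsilon>}) \<longlonglongrightarrow> 0"
      unfolding LIS_eq_lis by (rule lis_exponent_limit[OF assms g])
  qed
qed

end
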